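(* Let $J$ satisfy (A1)–(A3), let the admissible metric families $\mathcal D_1,\dots,\mathcal D_N$ satisfy (B1)–(B3), and let $\{z^k\}_{k\in\mathbb N}$, $z^k=(x_1^k,\dots,x_N^k)$, be the sequence generated by the iGGBPL algorithm with step sizes satisfying $\inf_{i\in[N],k\ge1}(\gamma_i^k-1)s_i^k>0$ and $\inf_{i\in[N],k\ge1}\sigma_i^k>0$ (all described in the context). Suppose that the desingularizing function of $J$ (in the uniformized KŁ property on the set of cluster points of $\{z^k\}$, see context) has the form $\phi(t)=\frac C\theta t^\theta$ with $\theta\in(0,1]$ and $C>0$. Let $J^*=\lim_{k\to\infty}J(z^k)$ and $r^k=|J(z^k)-J^*|$. Then: (i) If $\theta=1$, the algorithm terminates in finitely many steps (i.e. there is a finite index $k$ with $r^k=0$ and $z^{m}=z^k$ for all $m\ge k$). (ii) If $\theta\in[\frac12,1)$, then there exist a constant $c_1>0$, $q\in(0,1)$ and an integer $k_2$ such that $r^k\le c_1q^{k-k_2}$ for all $k\ge k_2$. (iii) If $\theta\in(0,\frac12)$, then there exist a constant $c_2>0$ and an integer $k_3$ such that $r^k\le c_2(k-k_3)^{-\frac1{1-2\theta}}$ for all $k>k_3$.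
   Context: Notation: $[N]=\{1,\dots,N\}$; $\langle\cdot,\cdot\rangle,\|\cdot\|$ are the Euclidean inner product and norm. Problem. Minimize $J(x_1,\dots,x_N)=H(x_1,\dots,x_N)+\sum_{i=1}^N F_i(x_i)$ over $\prod_{i=1}^N\mathbb R^{d_i}$. Assumptions: (A1) $H:\prod_i\mathbb R^{d_i}\to\mathbb R$ is continuously differentiable; for each $i$ and each choice of the other blocks, the partial gradient $x_i\mapsto\nabla_{x_i}H$ is Lipschitz on $\mathbb R^{d_i}$; and $\nabla H$ is Lipschitz on every bounded set. (A2) Each $F_i:\mathbb R^{d_i}\to(-\infty,+\infty]$ (equal to $+\infty$ outside a set $\mathbb D_{F_i}$) is proper, lower semicontinuous and bounded below. (A3) $J$ is a KŁ function, proper, coercive ($J(x)\to+\infty$ as $\|x\|\to\infty$) and bounded below. Subdifferentials and KŁ. The Fréchet subdifferential $\hat\partial f(x)$ of a proper lsc $f$ at $x\in\mathrm{dom} f$ is the set of $u$ with $\liminf_{y\to x,y\ne x}\frac{f(y)-f(x)-\langle u,y-x\rangle}{\|y-x\|}\ge0$ (empty if $x\notin\mathrm{dom} f$); the limiting subdifferential is $\partial f(x)=\{u:\exists x^k\to x, f(x^k)\to f(x), u^k\in\hat\partial f(x^k), u^k\to u\}$. A desingularization function is a concave continuous $\phi:[0,\eta)\to\mathbb R_+$ with $\phi(0)=0$, continuously differentiable on $(0,\eta)$ with $\phi'>0$. $f$ is a KŁ function if for every $\bar u$ with $\partial f(\bar u)\neq\emptyset$ there exist $\eta\in(0,+\infty]$,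 a neighborhood $U$ of $\bar u$ and a desingularization function $\phi$ on $[0,\eta)$ such that $\phi'(f(u)-f(\bar u))\,\mathrm{dist}(0,\partial f(u))\ge1$ for all $u\in U$ with $f(\bar u)<f(u)<f(\bar u)+\eta$. Uniformized KŁ property: for $\Omega$ the (nonempty, compact) set of cluster points of $\{z^k\}$, on which $J$ is constant, there exist $\epsilon>0$, $\eta>0$ and a desingularization function $\phi$ such that for every $\bar x\in\Omega$ and every $x$ with $\mathrm{dist}(x,\Omega)<\epsilon$ and $J(\bar x)<J(x)<J(\bar x)+\eta$ one has $\phi'(J(x)-J(\bar x))\,\mathrm{dist}(0,\partial J(x))\ge1$. The hypothesis of the theorem is that this holds with $\phi(t)=\frac C\theta t^\theta$. Admissible metrics. For each $i\in[N]$, $\mathcal D_i$ is a family of metrics on $\mathbb R^{d_i}$ such that: (B1) there exist a norm $\|\cdot\|_d$ (on $\mathbb R^{d_i}$) and a constant $C_d>0$ with $C_d\|x-y\|_d\le d(x,y)$ for all $x,y\in\mathbb R^{d_i}$, $d\in\mathcal D_i$; (B2) $d(\cdot,y)$ is convex for every $y\in\mathbb R^{d_i}$, $d\in\mathcal D_i$; (B3) $\omega_i(x,y):=\sup_{d\in\mathcal D_i}d(x,y)$ is bounded on every compact subset of $\mathbb R^{d_i}\times\mathbb R^{d_i}$. iGGBPL algorithm. Input: $x^1_{(N)}=x^0_{(N)}\in\mathrm{dom}\,J$, where $x^k_{(N)}=(x_1^k,\dots,x_N^k)$; $\rho_1>0$, $\beta^1=0$, $t_1=1$. For $k=1,2,3,\dots$: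 (1) Set $y_i^k=x_i^k+\beta^k(x_i^k-x_i^{k-1})$ for all $i$. (2) For $i=1,\dots,N$ successively: put $h_i(c)=H(x_1^{k+1},\dots,x_{i-1}^{k+1},c,x_{i+1}^k,\dots,x_N^k)$; choose any inner product $\langle u,v\rangle_{i,k}=\langle R_{i,k}u,v\rangle$ on $\mathbb R^{d_i}$ ($R_{i,k}$ symmetric positive definite) and any $d_i^k\in\mathcal D_i$; let $L_{i,k}>0$ be a constant such that $h_i(v)\le h_i(u)+\langle R_{i,k}^{-1}\nabla h_i(u),v-u\rangle_{i,k}+\frac{L_{i,k}}2(d_i^k(v,u))^2$ for all $u,v\in\mathbb R^{d_i}$; choose $s_i^k>L_{i,k}$, $\gamma_i^k>1$, $\sigma_i^k=1/(\gamma_i^ks_i^k)$; and choose $$x_i^{k+1}\in\arg\min_{x}\Big[F_i(x)+\tfrac1{2\sigma_i^k}(d_i^k(x,y_i^k))^2+\langle R_{i,k}^{-1}\nabla h_i(y_i^k),x-y_i^k\rangle_{i,k}\Big].$$ (3) If $J(x^{k+1}_{(N)})>J(x^k_{(N)})-\rho_1\sum_i(d_i^k(x_i^{k+1},x_i^k))^2$, set $\beta^k=0$ and redo (1)–(2) once (so that $y_i^k=x_i^k$); the result of this second pass is the final $x^{k+1}_{(N)}$. (4) $t_{k+1}=\frac{1+\sqrt{1+4t_k^2}}2$, $\beta^{k+1}=t_k/t_{k+1}$. All quantities with index $k$ refer to the pass that produced the final $x_{(N)}^{k+1}$. *)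

theory Defs
  imports "HOL-Analysis.Analysis"
begin

section \<open>Block structure\<close>

text \<open>
  The product of the spaces \<open>\<real>^(d_i)\<close>, \<open>i = 1..N\<close>, is the coordinate space \<open>real^'n\<close> together with a map
  \<open>blk\<close> from coordinates onto \<open>{1..N}\<close>; the dimension \<open>d_i\<close> is the number of coordinates that
  \<open>blk\<close> sends to \<open>i\<close>. The factor \<open>\<real>^(d_i)\<close> is identified with the coordinate subspace
  \<open>block_space blk i\<close>, with the inherited Euclidean structure.
\<close>

definition block_space :: "('n::finite \<Rightarrow> nat) \<Rightarrow> nat \<Rightarrow> (real^'n) set" where
  "block_space blk i = {x. \<forall>j. blk j \<noteq> i \<longrightarrow> x $ j = 0}"

definition block :: "('n::finite \<Rightarrow> nat) \<Rightarrow> nat \<Rightarrow> real^'n \<Rightarrow> real^'n" where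
  "block blk i x = (\<chi> j. if blk j = i then x $ j else 0)"

text \<open>\<open>splice blk i a c b\<close> is \<open>(a_1, ..., a_(i-1), c_i, b_(i+1), ..., b_N)\<close>.\<close>

definition splice :: "('n::finite \<Rightarrow> nat) \<Rightarrow> nat \<Rightarrow> real^'n \<Rightarrow> real^'n \<Rightarrow> real^'n \<Rightarrow> real^'n" where
  "splice blk i a c b =
     (\<chi> j. if blk j < i then a $ j else if blk j = i then c $ j else b $ j)"

section \<open>Gradients, semicontinuity\<close>

definition grad :: "('a::real_inner \<Rightarrow> real) \<Rightarrow> 'a \<Rightarrow> 'a" where
  "grad f x = (THE D. GDERIV f x :> D)"

definition proper_on :: "'a set \<Rightarrow> ('a \<Rightarrow> ereal) \<Rightarrow> bool" where
  "proper_on S f \<longleftrightarrow> (\<forall>x\<in>S. f x \<noteq> -\<infinity>) \<and> (\<exists>x\<in>S. f x \<noteq> \<infinity>)"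

definition lsc_on :: "'a::topological_space set \<Rightarrow> ('a \<Rightarrow> ereal) \<Rightarrow> bool" where
  "lsc_on S f \<longleftrightarrow> (\<forall>x\<in>S. f x \<le> Liminf (at x within S) f)"

definition bounded_below_on :: "'a set \<Rightarrow> ('a \<Rightarrow> ereal) \<Rightarrow> bool" where
  "bounded_below_on S f \<longleftrightarrow> (\<exists>m::real. \<forall>x\<in>S. ereal m \<le> f x)"

section \<open>Subdifferentials and the Kurdyka--Lojasiewicz property\<close>

definition frechet_subdiff :: "('a::euclidean_space \<Rightarrow> ereal) \<Rightarrow> 'a \<Rightarrow> 'a set" where
  "frechet_subdiff f x =
     (if f x = \<infinity> then {}
      else {u. 0 \<le> Liminf (at x)
                (\<lambda>y. (f y - f x - ereal (u \<bullet> (y - x))) / ereal (norm (y - x)))})"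

definition limiting_subdiff :: "('a::euclidean_space \<Rightarrow> ereal) \<Rightarrow> 'a \<Rightarrow> 'a set" where
  "limiting_subdiff f x =
     {u. \<exists>X U. X \<longlonglongrightarrow> x \<and> (\<lambda>k. f (X k)) \<longlonglongrightarrow> f x \<and>
           (\<forall>k. U k \<in> frechet_subdiff f (X k)) \<and> U \<longlonglongrightarrow> u}"

text \<open>
  Distance to a set with the convention that the distance to the empty set is \<open>\<infinity>\<close>
  (\<^const>\<open>infdist\<close> would return \<open>0\<close>, which is wrong where the subdifferential is empty).
\<close>

definition ereal_dist :: "'a::metric_space \<Rightarrow> 'a set \<Rightarrow> ereal" where
  "ereal_dist x S = (INF s\<in>S. ereal (dist x s))"

definition desingularizing :: "ereal \<Rightarrow> (real \<Rightarrow> real) \<Rightarrow> bool" where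
  "desingularizing \<eta> \<phi> \<longleftrightarrow>
     concave_on {t. 0 \<le> t \<and> ereal t < \<eta>} \<phi> \<and>
     continuous_on {t. 0 \<le> t \<and> ereal t < \<eta>} \<phi> \<and>
     (\<forall>t. 0 \<le> t \<and> ereal t < \<eta> \<longrightarrow> 0 \<le> \<phi> t) \<and>
     \<phi> 0 = 0 \<and>
     (\<forall>t. 0 < t \<and> ereal t < \<eta> \<longrightarrow> \<phi> differentiable (at t) \<and> 0 < deriv \<phi> t) \<and>
     continuous_on {t. 0 < t \<and> ereal t < \<eta>} (deriv \<phi>)"

definition KL_inequality ::
  "('a::euclidean_space \<Rightarrow> ereal) \<Rightarrow> (real \<Rightarrow> real) \<Rightarrow> 'a \<Rightarrow> 'a \<Rightarrow> bool" where
  "KL_inequality f \<phi> xbar x \<longleftrightarrow>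
     1 \<le> ereal (deriv \<phi> (real_of_ereal (f x - f xbar))) * ereal_dist 0 (limiting_subdiff f x)"

definition KL_function :: "('a::euclidean_space \<Rightarrow> ereal) \<Rightarrow> bool" where
  "KL_function f \<longleftrightarrow>
     (\<forall>ubar. limiting_subdiff f ubar \<noteq> {} \<longrightarrow>
        (\<exists>\<eta>>0. \<exists>U \<phi>. open U \<and> ubar \<in> U \<and> desingularizing \<eta> \<phi> \<and>
           (\<forall>u\<in>U. f ubar < f u \<and> f u < f ubar + \<eta> \<longrightarrow> KL_inequality f \<phi> ubar u)))"

definition uniformized_KL ::
  "('a::euclidean_space \<Rightarrow> ereal) \<Rightarrow> 'a set \<Rightarrow> (real \<Rightarrow> real) \<Rightarrow> bool" where
  "uniformized_KL f \<Omega> \<phi> \<longleftrightarrow>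
     (\<exists>\<epsilon>>0. \<exists>\<eta>>0. desingularizing \<eta> \<phi> \<and>
        (\<forall>xbar\<in>\<Omega>. \<forall>x. ereal_dist x \<Omega> < ereal \<epsilon> \<and> f xbar < f x \<and> f x < f xbar + \<eta> \<longrightarrow>
           KL_inequality f \<phi> xbar x))"

definition cluster_points :: "(nat \<Rightarrow> 'a::topological_space) \<Rightarrow> 'a set" where
  "cluster_points z = {x. \<exists>r. strict_mono r \<and> (\<lambda>k. z (r k)) \<longlonglongrightarrow> x}"

section \<open>The minimization problem\<close>

definition objective ::
  "('n::finite \<Rightarrow> nat) \<Rightarrow> nat \<Rightarrow> (real^'n \<Rightarrow> real) \<Rightarrow> (nat \<Rightarrow> real^'n \<Rightarrow> ereal) \<Rightarrow> real^'n \<Rightarrow> ereal" where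
  "objective blk N H F x = ereal (H x) + (\<Sum>i=1..N. F i (block blk i x))"

text \<open>
  As a function of \<open>c\<close> in the whole space, \<open>H (splice blk i x c x)\<close> depends only on block \<open>i\<close> of
  \<open>c\<close>; its gradient therefore lies in \<^term>\<open>block_space blk i\<close> and is the partial gradient
  of \<open>H\<close> with respect to block \<open>i\<close>. The same remark applies to \<open>h\<close> in \<open>ggbpl_pass\<close> below.
\<close>

definition smooth_coupling ::
  "('n::finite \<Rightarrow> nat) \<Rightarrow> nat \<Rightarrow> (real^'n \<Rightarrow> real) \<Rightarrow> bool" where
  "smooth_coupling blk N H \<longleftrightarrow>
     (\<forall>x. H differentiable (at x)) \<and> continuous_on UNIV (grad H) \<and>
     (\<forall>i\<in>{1..N}. \<forall>x. \<exists>L. L-lipschitz_on (block_space blk i) (grad (\<lambda>c. H (splice blk i x c x)))) \<and>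
     (\<forall>B. bounded B \<longrightarrow> (\<exists>L. L-lipschitz_on B (grad H)))"

definition admissible_terms ::
  "('n::finite \<Rightarrow> nat) \<Rightarrow> nat \<Rightarrow> (nat \<Rightarrow> real^'n \<Rightarrow> ereal) \<Rightarrow> bool" where
  "admissible_terms blk N F \<longleftrightarrow>
     (\<forall>i\<in>{1..N}. proper_on (block_space blk i) (F i) \<and> lsc_on (block_space blk i) (F i) \<and>
        bounded_below_on (block_space blk i) (F i))"

definition admissible_objective :: "('a::euclidean_space \<Rightarrow> ereal) \<Rightarrow> bool" where
  "admissible_objective J \<longleftrightarrow>
     KL_function J \<and> proper_on UNIV J \<and> (J \<longlongrightarrow> \<infinity>) at_infinity \<and> bounded_below_on UNIV J"

section \<open>Admissible metrics\<close>

definition norm_on :: "'a::real_vector set \<Rightarrow> ('a \<Rightarrow> real) \<Rightarrow> bool" where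
  "norm_on V \<nu> \<longleftrightarrow>
     (\<forall>u\<in>V. 0 \<le> \<nu> u \<and> (\<nu> u = 0 \<longleftrightarrow> u = 0)) \<and>
     (\<forall>u\<in>V. \<forall>a. \<nu> (a *\<^sub>R u) = \<bar>a\<bar> * \<nu> u) \<and>
     (\<forall>u\<in>V. \<forall>v\<in>V. \<nu> (u + v) \<le> \<nu> u + \<nu> v)"

definition admissible_metrics :: "'a::euclidean_space set \<Rightarrow> ('a \<Rightarrow> 'a \<Rightarrow> real) set \<Rightarrow> bool" where
  "admissible_metrics V D \<longleftrightarrow>
     (\<forall>d\<in>D. Metric_space V d) \<and>
     (\<exists>\<nu>. \<exists>c>0. norm_on V \<nu> \<and> (\<forall>d\<in>D. \<forall>x\<in>V. \<forall>y\<in>V. c * \<nu> (x - y) \<le> d x y)) \<and>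
     (\<forall>d\<in>D. \<forall>y\<in>V. convex_on V (\<lambda>x. d x y)) \<and>
     (\<forall>K. compact K \<and> K \<subseteq> V \<times> V \<longrightarrow>
        (\<exists>M::real. \<forall>(x, y)\<in>K. (SUP d\<in>D. ereal (d x y)) \<le> ereal M))"

section \<open>The iGGBPL algorithm\<close>

text \<open>
  Choices made for one block in one pass: the operator of the inner product, the metric, the
  constant \<open>L\<close>, and the parameters \<open>s\<close> and \<open>\<gamma>\<close>.
\<close>

record 'a block_choice =
  scaling :: "'a \<Rightarrow> 'a"
  metric :: "'a \<Rightarrow> 'a \<Rightarrow> real"
  Lconst :: real
  sparam :: real
  gparam :: real

definition step_size :: "'a block_choice \<Rightarrow> real" where
  "step_size c = 1 / (gparam c * sparam c)"

definition spd_on :: "'a::euclidean_space set \<Rightarrow> ('a \<Rightarrow> 'a) \<Rightarrow> bool" where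
  "spd_on V R \<longleftrightarrow>
     linear R \<and> R ` V \<subseteq> V \<and>
     (\<forall>u\<in>V. \<forall>v\<in>V. R u \<bullet> v = u \<bullet> R v) \<and> (\<forall>u\<in>V. u \<noteq> 0 \<longrightarrow> 0 < R u \<bullet> u)"

text \<open>
  \<open>ggbpl_pass blk N H F D \<beta> x' x ch p\<close>: one sweep over the blocks with extrapolation parameter
  \<open>\<beta>\<close>, previous iterate \<open>x'\<close>, current iterate \<open>x\<close> and choices \<open>ch 1, ..., ch N\<close> may produce \<open>p\<close>.
\<close>

definition ggbpl_pass ::
  "('n::finite \<Rightarrow> nat) \<Rightarrow> nat \<Rightarrow> (real^'n \<Rightarrow> real) \<Rightarrow> (nat \<Rightarrow> real^'n \<Rightarrow> ereal) \<Rightarrow>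
   (nat \<Rightarrow> (real^'n \<Rightarrow> real^'n \<Rightarrow> real) set) \<Rightarrow> real \<Rightarrow> real^'n \<Rightarrow> real^'n \<Rightarrow>
   (nat \<Rightarrow> (real^'n) block_choice) \<Rightarrow> real^'n \<Rightarrow> bool" where
  "ggbpl_pass blk N H F D \<beta> x' x ch p \<longleftrightarrow>
     (\<forall>i\<in>{1..N}.
        let V = block_space blk i;
            y = block blk i x + \<beta> *\<^sub>R (block blk i x - block blk i x');
            h = (\<lambda>c. H (splice blk i p c x));
            R = scaling (ch i);
            Rinv = inv_into V R;
            d = metric (ch i)
        in spd_on V R \<and> d \<in> D i \<and> 0 < Lconst (ch i) \<and>
           (\<forall>u\<in>V. \<forall>v\<in>V. h v \<le> h u + R (Rinv (grad h u)) \<bullet> (v - u) + Lconst (ch i) / 2 * (d v u)\<^sup>2) \<and>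
           Lconst (ch i) < sparam (ch i) \<and> 1 < gparam (ch i) \<and>
           is_arg_min
             (\<lambda>w. F i w + ereal (1 / (2 * step_size (ch i)) * (d w y)\<^sup>2 +
                                 R (Rinv (grad h y)) \<bullet> (w - y)))
             (\<lambda>w. w \<in> V) (block blk i p))"

definition sufficient_decrease ::
  "('n::finite \<Rightarrow> nat) \<Rightarrow> nat \<Rightarrow> (real^'n \<Rightarrow> real) \<Rightarrow> (nat \<Rightarrow> real^'n \<Rightarrow> ereal) \<Rightarrow> real \<Rightarrow>
   real^'n \<Rightarrow> (nat \<Rightarrow> (real^'n) block_choice) \<Rightarrow> real^'n \<Rightarrow> bool" where
  "sufficient_decrease blk N H F \<rho> x ch p \<longleftrightarrow>
     objective blk N H F p \<le> objective blk N H F x -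
       ereal (\<rho> * (\<Sum>i=1..N. (metric (ch i) (block blk i p) (block blk i x))\<^sup>2))"

text \<open>Starting from \<open>t_0 = 0\<close>, the recursion yields \<open>t_1 = 1\<close>, and \<open>\<beta>^1 = t_0 / t_1 = 0\<close>.\<close>

primrec t_seq :: "nat \<Rightarrow> real" where
  "t_seq 0 = 0"
| "t_seq (Suc k) = (1 + sqrt (1 + 4 * (t_seq k)\<^sup>2)) / 2"

definition extrapolation :: "nat \<Rightarrow> real" where
  "extrapolation k = t_seq (k - 1) / t_seq k"

lemma t_seq_1: "t_seq 1 = 1"
  by simp

lemma extrapolation_1: "extrapolation 1 = 0"
  by (simp add: extrapolation_def)

text \<open>
  \<open>ch k i\<close> records the choices for block \<open>i\<close> in the pass that produced \<open>z (k + 1)\<close>. The choices of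
  a rejected first pass are independent of those of the second pass and are not recorded.
\<close>

definition iGGBPL ::
  "('n::finite \<Rightarrow> nat) \<Rightarrow> nat \<Rightarrow> (real^'n \<Rightarrow> real) \<Rightarrow> (nat \<Rightarrow> real^'n \<Rightarrow> ereal) \<Rightarrow>
   (nat \<Rightarrow> (real^'n \<Rightarrow> real^'n \<Rightarrow> real) set) \<Rightarrow> real \<Rightarrow>
   (nat \<Rightarrow> nat \<Rightarrow> (real^'n) block_choice) \<Rightarrow> (nat \<Rightarrow> real^'n) \<Rightarrow> bool" where
  "iGGBPL blk N H F D \<rho> ch z \<longleftrightarrow>
     z 1 = z 0 \<and> objective blk N H F (z 0) < \<infinity> \<and> 0 < \<rho> \<and>
     (\<forall>k\<ge>1.
        (ggbpl_pass blk N H F D (extrapolation k) (z (k - 1)) (z k) (ch k) (z (k + 1)) \<and>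
         sufficient_decrease blk N H F \<rho> (z k) (ch k) (z (k + 1))) \<or>
        (\<exists>ch' p.
           ggbpl_pass blk N H F D (extrapolation k) (z (k - 1)) (z k) ch' p \<and>
           \<not> sufficient_decrease blk N H F \<rho> (z k) ch' p \<and>
           ggbpl_pass blk N H F D 0 (z (k - 1)) (z k) (ch k) (z (k + 1))))"

definition objective_gap :: "('a \<Rightarrow> ereal) \<Rightarrow> (nat \<Rightarrow> 'a) \<Rightarrow> nat \<Rightarrow> ereal" where
  "objective_gap J z k = \<bar>J (z k) - lim (\<lambda>m. J (z m))\<bar>"

end

(*
  A pass of the algorithm is analysed through the minimality of each block subproblem alone. Bounding
  d(w, y)^2 <= (d(p, y) + d(w, p))^2 by the triangle inequality, and d(u, v) <= M |u - v| on bounded sets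
  by convexity, every iterate p = z (k + 1) satisfies on a fixed ball

    J p <= J w + K (|z (k+1) - z k| + |z k - z (k-1)|) |w - p| + K |w - p|^2.

  Letting w -> p bounds the slope of J at p, hence dist(0, limiting subdifferential of J at p), without
  any subdifferential calculus for the metrics; letting p tend to a cluster point w shows that J takes
  its limit value at w. Together with the decrease of J by a multiple of |z (k+1) - z k|^2, the
  Kurdyka--Lojasiewicz inequality becomes r (k+2) powr (2 - 2 theta) <= K (r k - r (k+2)) for the gap r,
  from which the three rates follow.
*)
theory Submission
  imports Defs
begin

text \<open>The metrics are merely convex and may be nonsmooth, and the terms \<open>F i\<close> are
  merely lower semicontinuous. An optimality condition for a block subproblem would call for sum and
  chain rules, and the values of \<open>F i\<close> may drop in the limit at a cluster point.
  Comparing the subproblem at \<open>p\<close> with its value at an arbitrary \<open>w\<close> meets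
  both obstacles. It is sharp enough because in
  \<open>d(w, y)^2 - d(p, y)^2 <= 2 d(w, p) d(p, y) + d(w, p)^2\<close> the part linear in
  \<open>|w - p|\<close> carries the factor \<open>d(p, y)\<close>, which has the order of the last
  two steps, so the slope vanishes with the steps. Two steps occur because the extrapolated point
  \<open>y\<close> also involves the iterate before the current one; hence the recursion for the gap
  has stride two. Its exponent \<open>2 - 2 theta\<close> arises because
  \<open>phi'(t) = C t^(theta - 1)\<close> bounds \<open>r^(1 - theta)\<close> by step lengths,
  whereas the decrease controls their squares.\<close>

section \<open>Decay of real sequences under recursions of stride two\<close>

lemma powr_diff_upper:
  fixes \<beta> x :: real
  assumes "0 < \<beta>" "1 \<le> x"
  shows "x powr (- \<beta>) - (x + 2) powr (- \<beta>) \<le> 2 * \<beta> * 3 powr (\<beta> + 1) * (x + 2) powr (- \<beta> - 1)"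
proof -
  have "\<exists>t. x < t \<and> t < x + 2 \<and>
      (x + 2) powr (- \<beta>) - x powr (- \<beta>) = (x + 2 - x) * ((- \<beta>) * t powr (- \<beta> - 1))"
    using assms by (intro MVT2) (auto intro!: derivative_eq_intros)
  then obtain t where t: "x < t" "t < x + 2"
    and eq: "(x + 2) powr (- \<beta>) - x powr (- \<beta>) = 2 * ((- \<beta>) * t powr (- \<beta> - 1))"
    by auto
  \<comment> \<open>Since \<open>1 \<le> x\<close>, one has \<open>(x + 2) / 3 \<le> x < t\<close>,
    and the power is decreasing; this is the origin of the factor
    \<open>3 powr (\<beta> + 1)\<close>.\<close>
  have "t powr (- \<beta> - 1) \<le> ((x + 2) / 3) powr (- \<beta> - 1)"
    using assms t by (intro powr_mono2') auto
  also have "\<dots> = 3 powr (\<beta> + 1) * (x + 2) powr (- \<beta> - 1)"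
  proof -
    have "((x + 2) / 3) powr (- \<beta> - 1) = (x + 2) powr (- \<beta> - 1) / 3 powr (- \<beta> - 1)"
      using assms by (simp add: powr_divide)
    also have "3 powr (- \<beta> - 1) = 1 / (3::real) powr (\<beta> + 1)"
      using powr_minus_divide[of 3 "\<beta> + 1"] by simp
    finally show ?thesis by simp
  qed
  finally have "2 * \<beta> * t powr (- \<beta> - 1) \<le> 2 * \<beta> * (3 powr (\<beta> + 1) * (x + 2) powr (- \<beta> - 1))"
    using assms by (intro mult_left_mono) auto
  with eq show ?thesis by (simp add: algebra_simps)
qed

text \<open>With \<open>\<beta> = 1 / (\<alpha> - 1)\<close> one has
  \<open>\<beta> * \<alpha> = \<beta> + 1\<close>, so \<open>c * n powr (- \<beta>)\<close> balances
  the recursion: its power \<open>\<alpha>\<close> and its decrement over two steps both have order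
  \<open>n powr (- \<beta> - 1)\<close>, and a large \<open>c\<close> makes the first dominate.
  Index 0 is left out because \<open>0 powr _\<close> is 0.\<close>

lemma two_step_sublinear_rate:
  fixes a :: "nat \<Rightarrow> real" and \<alpha> K :: real
  assumes \<alpha>: "1 < \<alpha>" and K: "0 < K"
    and step: "\<And>n. a (n + 2) powr \<alpha> \<le> K * (a n - a (n + 2))"
  obtains c where "0 < c" "\<And>n. 1 \<le> n \<Longrightarrow> a n \<le> c * real n powr (- (1 / (\<alpha> - 1)))"
proof -
  define \<beta> where "\<beta> = 1 / (\<alpha> - 1)"
  have \<beta>: "0 < \<beta>" "\<beta> * \<alpha> = \<beta> + 1" "\<beta> * (\<alpha> - 1) = 1"
    using \<alpha> by (auto simp: \<beta>_def field_simps)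
  \<comment> \<open>The first two entries settle \<open>n = 1\<close> and \<open>n = 2\<close>,
    where the two parity classes start; the third solves \<open>c powr (\<alpha> - 1) = 2 * K *
    \<beta> * 3 powr (\<beta> + 1)\<close>, the threshold for the induction step.\<close>
  define c where "c = Max {a 1, a 2 * 2 powr \<beta>, (2 * K * \<beta> * 3 powr (\<beta> + 1)) powr \<beta>}"
  have c: "a 1 \<le> c" "a 2 * 2 powr \<beta> \<le> c" "(2 * K * \<beta> * 3 powr (\<beta> + 1)) powr \<beta> \<le> c"
    by (simp_all add: c_def)
  have pos: "0 < (2 * K * \<beta> * 3 powr (\<beta> + 1)) powr \<beta>"
    using K \<beta> by simp
  then have "0 < c" using c(3) by linarith
  have "2 * K * \<beta> * 3 powr (\<beta> + 1) = ((2 * K * \<beta> * 3 powr (\<beta> + 1)) powr \<beta>) powr (\<alpha> - 1)"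
    using K \<beta> by (simp add: powr_powr)
  also have "\<dots> \<le> c powr (\<alpha> - 1)"
    using c(3) \<alpha> by (intro powr_mono2) auto
  finally have c_large: "2 * K * \<beta> * 3 powr (\<beta> + 1) \<le> c powr (\<alpha> - 1)" .
  have bound: "a n \<le> c * real n powr (- \<beta>)" if "1 \<le> n" for n
    using that
  proof (induction n rule: less_induct)
    case (less n)
    consider "n = 1" | "n = 2" | m where "n = m + 2" "1 \<le> m"
      using less.prems that(3)[of "n - 2"] by linarith
    then show ?case
    proof cases
      case 1
      then show ?thesis using c by simp
    next
      case 2
      then show ?thesis using c(2) by (simp add: powr_minus_divide field_simps)
    next
      case 3
      have IH: "a m \<le> c * real m powr (- \<beta>)"
        using less.IH[of m] 3 by simp
      show ?thesis
      proof (rule ccontr)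
        define X where "X = real m + 2"
        \<comment> \<open>If the bound fails at \<open>m + 2\<close>, the recursion forces a drop
          from \<open>a m\<close> to \<open>a (m + 2)\<close> larger than the upper bound on
          \<open>a m\<close> and the lower bound on \<open>a (m + 2)\<close> leave room for.\<close>
        assume "\<not> ?thesis"
        then have big: "c * X powr (- \<beta>) < a (m + 2)"
          using 3 by (simp add: X_def add.commute)
        have Xpos: "0 < X" by (simp add: X_def)
        have "(c * X powr (- \<beta>)) powr \<alpha> \<le> a (m + 2) powr \<alpha>"
          using big \<alpha> \<open>0 < c\<close> by (intro powr_mono2) auto
        also have "(c * X powr (- \<beta>)) powr \<alpha> = c powr \<alpha> * X powr (- \<beta> - 1)"
          using \<open>0 < c\<close> \<beta>(2) by (simp add: powr_mult powr_powr)
        also have "c powr \<alpha> = c * c powr (\<alpha> - 1)"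
          using powr_add[of c 1 "\<alpha> - 1"] \<open>0 < c\<close> by simp
        finally have low: "c * c powr (\<alpha> - 1) * X powr (- \<beta> - 1) \<le> K * (a m - a (m + 2))"
          using step[of m] by linarith
        have "c * (real m powr (- \<beta>) - X powr (- \<beta>))
            \<le> c * (2 * \<beta> * 3 powr (\<beta> + 1) * X powr (- \<beta> - 1))"
          using powr_diff_upper[of \<beta> "real m"] 3 \<beta> \<open>0 < c\<close>
          by (intro mult_left_mono) (auto simp: X_def)
        then have "a m - a (m + 2) < c * (2 * \<beta> * 3 powr (\<beta> + 1) * X powr (- \<beta> - 1))"
          using IH big by (simp add: algebra_simps)
        then have "K * (a m - a (m + 2)) < K * (c * (2 * \<beta> * 3 powr (\<beta> + 1) * X powr (- \<beta> - 1)))"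
          using K by simp
        also have "\<dots> = (2 * K * \<beta> * 3 powr (\<beta> + 1)) * (c * X powr (- \<beta> - 1))"
          by simp
        also have "\<dots> \<le> c powr (\<alpha> - 1) * (c * X powr (- \<beta> - 1))"
          using c_large \<open>0 < c\<close> by (intro mult_right_mono) auto
        finally show False using low by (simp add: algebra_simps)
      qed
    qed
  qed
  then show ?thesis
    using that[of c] \<open>0 < c\<close> by (simp add: \<beta>_def)
qed

text \<open>For values in \<open>(0, 1]\<close> and \<open>\<alpha> \<le> 1\<close>, raising to the
  power \<open>\<alpha>\<close> does not decrease them, so the recursion gives
  \<open>(1 + K) * a (n + 2) \<le> K * a n\<close>: a contraction by
  \<open>q^2 = K / (1 + K)\<close> every two steps. The prefactor \<open>1 / q\<close> is what
  \<open>n = 1\<close> costs.\<close>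

lemma two_step_linear_rate:
  fixes a :: "nat \<Rightarrow> real" and \<alpha> K :: real
  assumes \<alpha>: "\<alpha> \<le> 1" and K: "0 < K" and nonneg: "\<And>n. 0 \<le> a n" and small: "\<And>n. a n \<le> 1"
    and step: "\<And>n. 0 < a (n + 2) \<Longrightarrow> a (n + 2) powr \<alpha> \<le> K * (a n - a (n + 2))"
  obtains c q where "0 < c" "0 < q" "q < 1" "\<And>n. a n \<le> c * q ^ n"
proof -
  define q where "q = sqrt (K / (1 + K))"
  have q: "0 < q" "q < 1" "q\<^sup>2 = K / (1 + K)"
    using K by (auto simp: q_def)
  have contr: "a (n + 2) \<le> q\<^sup>2 * a n" for n
  proof (cases "a (n + 2) = 0")
    case True
    then show ?thesis using nonneg[of n] by simp
  next
    case False
    then have pos: "0 < a (n + 2)" using nonneg[of "n + 2"] by simp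
    have "a (n + 2) = a (n + 2) powr 1" using pos by simp
    also have "\<dots> \<le> a (n + 2) powr \<alpha>"
      using powr_mono'[of \<alpha> 1 "a (n + 2)"] \<alpha> small[of "n + 2"] pos by simp
    also have "\<dots> \<le> K * (a n - a (n + 2))" using step[OF pos] .
    finally have "(1 + K) * a (n + 2) \<le> K * a n" by (simp add: algebra_simps)
    then have "a (n + 2) \<le> K * a n / (1 + K)" using K by (simp add: pos_le_divide_eq mult.commute)
    then show ?thesis using q(3) by simp
  qed
  have bound: "a n \<le> 1 / q * q ^ n" for n
  proof (induction n rule: less_induct)
    case (less n)
    consider "n = 0" | "n = 1" | m where "n = m + 2"
      using that(3)[of "n - 2"] by linarith
    then show ?case
    proof cases
      case 1
      have "1 \<le> 1 / q" using q by (simp add: field_simps)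
      then show ?thesis using small[of 0] 1 by simp
    next
      case 2
      then show ?thesis using small[of 1] q by simp
    next
      case 3
      have "a n \<le> q\<^sup>2 * a m" using contr[of m] 3 by simp
      also have "\<dots> \<le> q\<^sup>2 * (1 / q * q ^ m)"
        using less.IH[of m] 3 by (intro mult_left_mono) auto
      also have "\<dots> = 1 / q * q ^ n" using 3 by (simp add: power_add power2_eq_square)
      finally show ?thesis .
    qed
  qed
  show ?thesis using that[of "1 / q" q] q bound by simp
qed

section \<open>Lower semicontinuous extended-real functions\<close>

lemma lsc_onD:
  assumes "lsc_on S f" "x \<in> S" "a < f x"
  shows "eventually (\<lambda>y. a < f y) (at x within S)"
  using assms by (auto simp: lsc_on_def le_Liminf_iff)

text \<open>The limit in \<open>lsc_on\<close> is punctured; as the level lies below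
  \<open>f x\<close>, the point \<open>x\<close> can be added back.\<close>

lemma lsc_on_eventually_nhds:
  assumes "lsc_on UNIV f" "a < f x"
  shows "eventually (\<lambda>y. a < f y) (nhds x)"
  using lsc_onD[OF assms(1) UNIV_I assms(2)] assms(2) by (auto simp: eventually_nhds_conv_at)

lemma lsc_on_UNIV_I:
  assumes "\<And>x a. a < f x \<Longrightarrow> eventually (\<lambda>y. a < f y) (nhds x)"
  shows "lsc_on UNIV f"
  using assms by (auto simp: lsc_on_def le_Liminf_iff eventually_nhds_conv_at)

lemma lsc_on_UNIV_LIMSEQ_le:
  fixes f :: "'a::topological_space \<Rightarrow> ereal"
  assumes f: "lsc_on UNIV f" and X: "X \<longlonglongrightarrow> x" and fX: "(\<lambda>n. f (X n)) \<longlonglongrightarrow> m"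
  shows "f x \<le> m"
proof (rule ccontr)
  assume "\<not> f x \<le> m"
  then obtain a where a: "m < a" "a < f x"
    using dense[of m "f x"] by (auto simp: not_le)
  have "eventually (\<lambda>n. a < f (X n)) sequentially"
    using lsc_on_eventually_nhds[OF f a(2)] X by (rule eventually_compose_filterlim)
  then have "a \<le> m"
    using fX by (intro tendsto_lowerbound[of _ m sequentially a]) (auto elim: eventually_mono)
  with a show False by simp
qed

lemma lsc_on_UNIV_add:
  fixes f g :: "'a::topological_space \<Rightarrow> ereal"
  assumes f: "lsc_on UNIV f" and g: "lsc_on UNIV g"
    and fm: "\<And>x. f x \<noteq> -\<infinity>" and gm: "\<And>x. g x \<noteq> -\<infinity>"
  shows "lsc_on UNIV (\<lambda>x. f x + g x)"
proof (rule lsc_on_UNIV_I)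
  fix x a assume a: "a < f x + g x"
  \<comment> \<open>The level \<open>a\<close> is split between the summands. When
    \<open>f x\<close> is infinite, any real \<open>c\<close> below \<open>g x\<close> will do,
    because \<open>a - c\<close> stays below infinity.\<close>
  have "\<exists>b c. b < f x \<and> c < g x \<and> a \<le> b + c"
  proof -
    have "a - f x < g x \<or> f x = \<infinity>"
      using a fm[of x] by (cases a; cases "f x"; cases "g x") auto
    then show ?thesis
    proof
      assume "f x = \<infinity>"
      obtain c where c: "ereal c < g x"
        using gm[of x] that[of "real_of_ereal (g x) - 1"] by (cases "g x") auto
      have "a < \<infinity>" using a by (cases a) auto
      then have "a \<le> (a - ereal c) + ereal c \<and> a - ereal c < \<infinity>"
        by (cases a) auto
      with c \<open>f x = \<infinity>\<close> show ?thesis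
        by (intro exI[of _ "a - ereal c"] exI[of _ "ereal c"]) simp
    next
      assume "a - f x < g x"
      then obtain c where c: "a - f x < ereal c" "ereal c < g x"
        using ereal_dense2 by blast
      have "a - ereal c < f x"
        using c(1) fm[of x] by (cases a; cases "f x") auto
      moreover have "a \<le> (a - ereal c) + ereal c" by (cases a) auto
      ultimately show ?thesis using c(2) by blast
    qed
  qed
  then obtain b c where bc: "b < f x" "c < g x" "a \<le> b + c" by blast
  have "eventually (\<lambda>y. b < f y \<and> c < g y) (nhds x)"
    using lsc_on_eventually_nhds[OF f bc(1)] lsc_on_eventually_nhds[OF g bc(2)]
    by (rule eventually_conj)
  then show "eventually (\<lambda>y. a < f y + g y) (nhds x)"
  proof (rule eventually_mono)
    fix y assume "b < f y \<and> c < g y"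
    then show "a < f y + g y"
      using bc(3) by (meson ereal_add_strict_mono2 order_le_less_trans)
  qed
qed

lemma lsc_on_UNIV_sum:
  fixes f :: "'i \<Rightarrow> 'a::topological_space \<Rightarrow> ereal"
  assumes "finite I" "\<And>i. i \<in> I \<Longrightarrow> lsc_on UNIV (f i)" "\<And>i x. i \<in> I \<Longrightarrow> f i x \<noteq> -\<infinity>"
  shows "lsc_on UNIV (\<lambda>x. \<Sum>i\<in>I. f i x) \<and> (\<forall>x. (\<Sum>i\<in>I. f i x) \<noteq> -\<infinity>)"
  using assms
proof (induction I rule: finite_induct)
  case empty
  then show ?case by (auto intro: lsc_on_UNIV_I)
next
  case (insert i I)
  have "lsc_on UNIV (\<lambda>x. f i x + (\<Sum>i\<in>I. f i x))"
    using insert by (intro lsc_on_UNIV_add) auto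
  then show ?case using insert by auto
qed

lemma lsc_on_UNIV_continuous:
  assumes "continuous_on UNIV f"
  shows "lsc_on UNIV (\<lambda>x. ereal (f x))"
proof (rule lsc_on_UNIV_I)
  fix x a assume a: "a < ereal (f x)"
  have "(f \<longlongrightarrow> f x) (nhds x)"
    using assms by (simp add: continuous_on_def flip: tendsto_at_iff_tendsto_nhds)
  then have "((\<lambda>x. ereal (f x)) \<longlongrightarrow> ereal (f x)) (nhds x)"
    by simp
  then show "eventually (\<lambda>y. a < ereal (f y)) (nhds x)"
    using a by (rule order_tendstoD(1))
qed

lemma lsc_on_UNIV_compose:
  assumes f: "lsc_on S f" and g: "continuous_on UNIV g" and gS: "\<And>x. g x \<in> S"
  shows "lsc_on UNIV (\<lambda>x. f (g x))"
proof (rule lsc_on_UNIV_I)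
  fix x a assume a: "a < f (g x)"
  have "eventually (\<lambda>y. a < f y) (at (g x) within S)"
    using lsc_onD[OF f gS a] .
  then have "eventually (\<lambda>y. y \<in> S \<longrightarrow> a < f y) (nhds (g x))"
    using a by (auto simp: eventually_at_filter elim!: eventually_mono)
  moreover have "(g \<longlongrightarrow> g x) (nhds x)"
    using g by (simp add: continuous_on_def flip: tendsto_at_iff_tendsto_nhds)
  ultimately have "eventually (\<lambda>y. g y \<in> S \<longrightarrow> a < f (g y)) (nhds x)"
    by (rule eventually_compose_filterlim)
  then show "eventually (\<lambda>y. a < f (g y)) (nhds x)"
    using gS by simp
qed

text \<open>The direct method: a minimising sequence has a subsequence converging in
  \<open>K\<close>, and lower semicontinuity keeps the value at the limit at or below the
  infimum.\<close>

lemma lsc_attains_min: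
  fixes f :: "'a::metric_space \<Rightarrow> ereal"
  assumes f: "lsc_on UNIV f" and K: "compact K" "K \<noteq> {}"
  obtains x where "x \<in> K" "\<And>y. y \<in> K \<Longrightarrow> f x \<le> f y"
proof -
  have "f ` K \<noteq> {}" using K by simp
  then obtain u where u: "range u \<subseteq> f ` K" "u \<longlonglongrightarrow> Inf (f ` K)"
    using Inf_as_limit[of "f ` K"] by (metis image_subset_iff)
  then have "\<forall>n. \<exists>x. x \<in> K \<and> u n = f x" by auto
  then obtain X where X: "\<And>n. X n \<in> K" "\<And>n. u n = f (X n)" by metis
  obtain l s where l: "l \<in> K" "strict_mono s" "(X \<circ> s) \<longlonglongrightarrow> l"
    using K(1) X(1) unfolding compact_def by blast
  have "(\<lambda>n. f ((X \<circ> s) n)) \<longlonglongrightarrow> Inf (f ` K)"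
    using LIMSEQ_subseq_LIMSEQ[OF u(2) l(2)] X(2) by (simp add: o_def)
  then have "f l \<le> Inf (f ` K)"
    using lsc_on_UNIV_LIMSEQ_le[OF f l(3)] by simp
  then have "f l \<le> f y" if "y \<in> K" for y
    using that by (meson INF_lower order_trans)
  with l(1) that show ?thesis by blast
qed

section \<open>Limiting subgradients from a slope bound\<close>

text \<open>Fermat's rule with a smooth perturbation: minimality gives
  \<open>f y - f u \<ge> q u - q y\<close>, and the right side is the pairing of \<open>- D\<close>
  with \<open>y - u\<close> up to an error of smaller order than
  \<open>norm (y - u)\<close>.\<close>

lemma frechet_subdiff_of_local_min:
  fixes f :: "'a::euclidean_space \<Rightarrow> ereal"
  assumes fu: "f u = ereal r"
    and min: "eventually (\<lambda>y. f u + ereal (q u) \<le> f y + ereal (q y)) (at u)"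
    and q: "(q has_derivative (\<lambda>h. h \<bullet> D)) (at u)"
  shows "- D \<in> frechet_subdiff f u"
proof -
  have "eventually (\<lambda>y. c < (f y - f u - ereal ((- D) \<bullet> (y - u))) / ereal (norm (y - u))) (at u)"
    if c: "c < 0" for c
  proof -
    obtain e where e: "0 < e" "c < ereal (- e)"
    proof (cases c)
      case (real t)
      then show ?thesis using c that[of "- t / 2"] by simp
    next
      case MInf
      then show ?thesis using that[of 1] by simp
    qed (use c in auto)
    have "\<exists>d>0. \<forall>y. norm (y - u) < d \<longrightarrow> \<bar>q y - q u - (y - u) \<bullet> D\<bar> \<le> e * norm (y - u)"
      using q e(1) by (simp add: has_derivative_at_alt)
    then obtain d where d: "0 < d"
      "\<And>y. norm (y - u) < d \<Longrightarrow> \<bar>q y - q u - (y - u) \<bullet> D\<bar> \<le> e * norm (y - u)"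
      by auto
    have "eventually (\<lambda>y. norm (y - u) < d) (at u)"
      using d(1) by (auto simp: eventually_at dist_norm)
    moreover have "eventually (\<lambda>y. y \<noteq> u) (at u)"
      by (simp add: eventually_at_filter)
    ultimately show ?thesis
      using min
    proof eventually_elim
      case (elim y)
      have pos: "0 < norm (y - u)" using elim by simp
      show ?case
      proof (cases "f y")
        case (real t)
        have "r + q u \<le> t + q y" using elim(3) fu real by simp
        with d(2)[OF elim(1)]
        have "- e * norm (y - u) \<le> t - r - (- D) \<bullet> (y - u)"
          by (simp add: inner_commute[of "y - u" D])
        then have "- e \<le> (t - r - (- D) \<bullet> (y - u)) / norm (y - u)"
          using pos by (simp add: pos_le_divide_eq)
        with e(2) have "c < ereal ((t - r - (- D) \<bullet> (y - u)) / norm (y - u))"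
          by (meson ereal_less_eq(3) order_less_le_trans)
        then show ?thesis using real fu pos by simp
      next
        case PInf
        then show ?thesis using fu pos e(2) by (cases c) auto
      next
        case MInf
        then show ?thesis using elim(3) fu by simp
      qed
    qed
  qed
  then show ?thesis
    using fu by (auto simp: frechet_subdiff_def le_Liminf_iff)
qed

text \<open>A smooth substitute for \<open>a * norm (u - p)\<close>, which for nonzero
  \<open>a\<close> fails to be differentiable at \<open>p\<close>, where a minimiser may well
  sit.\<close>

lemma smoothed_norm_has_derivative:
  fixes p u :: "'a::euclidean_space"
  assumes "0 < s"
  shows "((\<lambda>u. a * sqrt ((u - p) \<bullet> (u - p) + s\<^sup>2)) has_derivative
     (\<lambda>h. h \<bullet> ((a / sqrt ((u - p) \<bullet> (u - p) + s\<^sup>2)) *\<^sub>R (u - p)))) (at u)"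
proof -
  have pos: "0 < (u - p) \<bullet> (u - p) + s\<^sup>2"
    using assms by (simp add: add_nonneg_pos)
  have "((\<lambda>u. (u - p) \<bullet> (u - p) + s\<^sup>2) has_derivative (\<lambda>h. 2 * (h \<bullet> (u - p)))) (at u)"
    by (rule has_derivative_eq_rhs, (rule derivative_intros)+) (simp add: fun_eq_iff inner_commute)
  from has_derivative_mult_right[OF has_derivative_real_sqrt[OF pos this], of a]
  show ?thesis
    by (rule has_derivative_eq_rhs) (simp add: fun_eq_iff, simp only: divide_inverse mult.assoc, simp)
qed

text \<open>
  Minimising \<open>f + a * sqrt (|u - p|^2 + s^2)\<close> near \<open>p\<close>, with \<open>a\<close> slightly above the slope, yields
  minimisers \<open>u_s\<close> within \<open>O(s)\<close> of \<open>p\<close> at which the smooth term has gradient of norm at most \<open>a\<close>.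
\<close>

lemma limiting_subdiff_of_slope:
  fixes f :: "'a::euclidean_space \<Rightarrow> ereal"
  assumes lsc: "lsc_on UNIV f" and ninf: "\<And>x. f x \<noteq> -\<infinity>" and fp: "f p = ereal r"
    and b: "0 \<le> b" "b < a" and \<delta>: "0 < \<delta>"
    and slope: "\<And>u. dist p u \<le> \<delta> \<Longrightarrow> f p \<le> f u + ereal (b * norm (u - p))"
  shows "\<exists>w \<in> limiting_subdiff f p. norm w \<le> a"
proof -
  define q where "q s u = a * sqrt ((u - p) \<bullet> (u - p) + s\<^sup>2)" for s u
  \<comment> \<open>The scale is chosen so that \<open>a * s n / (a - b)\<close>, the bound on the
    distance of the minimisers to \<open>p\<close>, is at most \<open>\<delta> / 2\<close>; they
    then lie in the interior of the ball and are local minimisers.\<close>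
  define s where "s n = \<delta> * (a - b) / (2 * a) * inverse (real (Suc n))" for n
  have s_pos: "0 < s n" for n using \<delta> b by (simp add: s_def)
  have s_lim: "s \<longlonglongrightarrow> 0"
    unfolding s_def using tendsto_mult_right_zero[OF LIMSEQ_inverse_real_of_nat] by blast
  have s_small: "a * s n / (a - b) < \<delta>" for n
  proof -
    have "a * s n / (a - b) = \<delta> / 2 * inverse (real (Suc n))"
      using b by (simp add: s_def divide_simps)
    also have "\<dots> \<le> \<delta> / 2 * 1"
      using \<delta> by (intro mult_left_mono) (auto simp: inverse_le_1_iff)
    finally show ?thesis using \<delta> by linarith
  qed
  have q_ge: "a * norm (u - p) \<le> q t u" for t u
  proof -
    have "norm (u - p) = sqrt ((u - p) \<bullet> (u - p))" by (simp add: norm_eq_sqrt_inner)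
    also have "\<dots> \<le> sqrt ((u - p) \<bullet> (u - p) + t\<^sup>2)" by simp
    finally show ?thesis using b by (simp add: q_def)
  qed
  have q_p: "q (s n) p = a * s n" for n
    using s_pos[of n] by (simp add: q_def)
  have "\<exists>u. u \<in> cball p \<delta> \<and> (\<forall>y \<in> cball p \<delta>. f u + ereal (q (s n) u) \<le> f y + ereal (q (s n) y))" for n
  proof -
    have "lsc_on UNIV (\<lambda>u. f u + ereal (q (s n) u))"
      unfolding q_def
      by (intro lsc_on_UNIV_add lsc lsc_on_UNIV_continuous continuous_intros ninf) auto
    from lsc_attains_min[OF this compact_cball[of p \<delta>]] show ?thesis
      using \<delta> by (metis cball_eq_empty linorder_not_le order_less_asym)
  qed
  then obtain X where X: "\<And>n. X n \<in> cball p \<delta>"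
    and Xmin: "\<And>n y. y \<in> cball p \<delta> \<Longrightarrow> f (X n) + ereal (q (s n) (X n)) \<le> f y + ereal (q (s n) y)"
    by metis
  have le_p: "f (X n) + ereal (q (s n) (X n)) \<le> ereal (r + a * s n)" for n
    using Xmin[of p n] \<delta> fp q_p by simp
  have "\<exists>t. f (X n) = ereal t" for n
    using le_p[of n] ninf[of "X n"] by (cases "f (X n)") auto
  then obtain g where g: "\<And>n. f (X n) = ereal (g n)" by metis
  have upper: "g n + q (s n) (X n) \<le> r + a * s n" for n
    using le_p[of n] g by simp
  have lower: "r \<le> g n + b * norm (X n - p)" for n
    using slope[of "X n"] X[of n] fp g by simp
  \<comment> \<open>Minimality against \<open>p\<close> bounds
    \<open>f (X n) + a * norm (X n - p)\<close> above by \<open>r + a * s n\<close>, and the slope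
    hypothesis bounds \<open>f (X n) + b * norm (X n - p)\<close> below by \<open>r\<close>.
    Subtracting leaves the positive factor \<open>a - b\<close>.\<close>
  have near: "norm (X n - p) \<le> a * s n / (a - b)" for n
  proof -
    have "a * norm (X n - p) - b * norm (X n - p) \<le> a * s n"
      using upper[of n] lower[of n] q_ge[of "X n" "s n"] by linarith
    then show ?thesis using b by (simp add: pos_le_divide_eq algebra_simps)
  qed
  have bound_lim: "(\<lambda>n. a * s n / (a - b)) \<longlonglongrightarrow> 0"
    using tendsto_divide[OF tendsto_mult[OF tendsto_const s_lim] tendsto_const, of "a - b" a] b by simp
  have norm_lim: "(\<lambda>n. norm (X n - p)) \<longlonglongrightarrow> 0"
    by (rule tendsto_sandwich[OF _ _ tendsto_const bound_lim]) (use near in auto)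
  then have X_lim: "X \<longlonglongrightarrow> p"
    by (simp add: tendsto_norm_zero_iff LIM_zero_iff)
  \<comment> \<open>The limiting subdifferential also asks for convergence of the values, which
    lower semicontinuity alone does not give.\<close>
  have g_lim: "g \<longlonglongrightarrow> r"
  proof (rule tendsto_sandwich)
    show "eventually (\<lambda>n. r - b * norm (X n - p) \<le> g n) sequentially"
      using lower by (auto simp: algebra_simps)
    have "g n \<le> r + a * s n" for n
      using upper[of n] q_ge[of "X n" "s n"] b
      by (smt (verit) mult_nonneg_nonneg norm_ge_zero)
    then show "eventually (\<lambda>n. g n \<le> r + a * s n) sequentially" by simp
    show "(\<lambda>n. r - b * norm (X n - p)) \<longlonglongrightarrow> r"
      using tendsto_diff[OF tendsto_const tendsto_mult[OF tendsto_const norm_lim], of r b] by simp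
    show "(\<lambda>n. r + a * s n) \<longlonglongrightarrow> r"
      using tendsto_add[OF tendsto_const tendsto_mult[OF tendsto_const s_lim], of r a] by simp
  qed
  define U where "U n = - ((a / sqrt ((X n - p) \<bullet> (X n - p) + (s n)\<^sup>2)) *\<^sub>R (X n - p))" for n
  have U: "U n \<in> frechet_subdiff f (X n)" for n
    unfolding U_def
  proof (rule frechet_subdiff_of_local_min[where q = "q (s n)"])
    show "f (X n) = ereal (g n)" by (rule g)
    have "X n \<in> ball p \<delta>"
      using near[of n] s_small[of n] by (simp add: dist_norm norm_minus_commute)
    then have "eventually (\<lambda>y. y \<in> ball p \<delta>) (at (X n))"
      by (intro eventually_at_in_open') auto
    then show "eventually (\<lambda>y. f (X n) + ereal (q (s n) (X n)) \<le> f y + ereal (q (s n) y)) (at (X n))"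
      by eventually_elim (use Xmin in \<open>auto intro: less_imp_le\<close>)
    show "(q (s n) has_derivative
        (\<lambda>h. h \<bullet> ((a / sqrt ((X n - p) \<bullet> (X n - p) + (s n)\<^sup>2)) *\<^sub>R (X n - p)))) (at (X n))"
      using smoothed_norm_has_derivative[OF s_pos] by (simp add: q_def[abs_def])
  qed
  have U_norm: "norm (U n) \<le> a" for n
  proof -
    define v where "v = sqrt ((X n - p) \<bullet> (X n - p) + (s n)\<^sup>2)"
    have "0 < v" using s_pos[of n] by (simp add: v_def add_nonneg_pos)
    have "norm (X n - p) \<le> v"
      by (simp add: v_def norm_eq_sqrt_inner)
    then have "a * norm (X n - p) \<le> a * v" using b by (intro mult_left_mono) auto
    then show ?thesis
      using \<open>0 < v\<close> b by (simp add: U_def pos_divide_le_eq flip: v_def)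
  qed
  obtain w \<sigma> where w: "w \<in> cball 0 a" "strict_mono (\<sigma> :: nat \<Rightarrow> nat)" "(U \<circ> \<sigma>) \<longlonglongrightarrow> w"
    using compact_cball[of "0::'a" a] U_norm unfolding compact_def by (metis mem_cball_0)
  have "w \<in> limiting_subdiff f p"
    unfolding limiting_subdiff_def mem_Collect_eq
  proof (intro exI conjI allI)
    show "(X \<circ> \<sigma>) \<longlonglongrightarrow> p" using LIMSEQ_subseq_LIMSEQ[OF X_lim w(2)] .
    show "(\<lambda>k. f ((X \<circ> \<sigma>) k)) \<longlonglongrightarrow> f p"
      using LIMSEQ_subseq_LIMSEQ[OF g_lim w(2)] by (simp add: g fp o_def)
    show "(U \<circ> \<sigma>) k \<in> frechet_subdiff f ((X \<circ> \<sigma>) k)" for k using U by simp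
    show "(U \<circ> \<sigma>) \<longlonglongrightarrow> w" by (rule w(3))
  qed
  with w(1) show ?thesis by auto
qed

text \<open>On a small ball the quadratic term is at most \<open>e / 2\<close> times the distance,
  so \<open>E + e / 2\<close> bounds the slope and some limiting subgradient has norm at most
  \<open>E + e\<close>; \<open>e\<close> is arbitrary. Since \<open>ereal_dist\<close> to the empty
  set is infinite, the bound includes that subgradients exist.\<close>

lemma ereal_dist_limiting_subdiff_le_slope:
  fixes f :: "'a::euclidean_space \<Rightarrow> ereal"
  assumes lsc: "lsc_on UNIV f" and ninf: "\<And>x. f x \<noteq> -\<infinity>" and fp: "f p = ereal r"
    and E: "0 \<le> E" and \<delta>: "0 < \<delta>"
    and slope: "\<And>u. dist p u \<le> \<delta> \<Longrightarrow>
      f p \<le> f u + ereal (E * norm (u - p) + B * (norm (u - p))\<^sup>2)"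
  shows "ereal_dist 0 (limiting_subdiff f p) \<le> ereal E"
proof (rule ereal_le_epsilon2)
  fix e :: real assume e: "0 < e"
  define \<delta>' where "\<delta>' = min \<delta> (e / (2 * (\<bar>B\<bar> + 1)))"
  have \<delta>': "0 < \<delta>'" using \<delta> e by (simp add: \<delta>'_def)
  have "\<exists>w \<in> limiting_subdiff f p. norm w \<le> E + e"
  proof (rule limiting_subdiff_of_slope[OF lsc ninf fp _ _ \<delta>', of "E + e / 2"])
    fix u assume u: "dist p u \<le> \<delta>'"
    have "B * norm (u - p) \<le> (\<bar>B\<bar> + 1) * (e / (2 * (\<bar>B\<bar> + 1)))"
      using u by (intro mult_mono) (auto simp: \<delta>'_def dist_norm norm_minus_commute)
    also have "\<dots> = e / 2" by (simp add: field_simps)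
    finally have "B * norm (u - p) * norm (u - p) \<le> e / 2 * norm (u - p)"
      by (intro mult_right_mono) auto
    then have "ereal (E * norm (u - p) + B * (norm (u - p))\<^sup>2) \<le> ereal ((E + e / 2) * norm (u - p))"
      by (simp add: power2_eq_square algebra_simps)
    moreover have "f p \<le> f u + ereal (E * norm (u - p) + B * (norm (u - p))\<^sup>2)"
      using slope[of u] u by (simp add: \<delta>'_def)
    ultimately show "f p \<le> f u + ereal ((E + e / 2) * norm (u - p))"
      by (meson add_left_mono order_trans)
  qed (use E e in auto)
  then obtain w where w: "w \<in> limiting_subdiff f p" "norm w \<le> E + e" by blast
  have "ereal_dist 0 (limiting_subdiff f p) \<le> ereal (dist 0 w)"
    unfolding ereal_dist_def using w(1) by (rule INF_lower)
  also have "\<dots> \<le> ereal E + ereal e" using w(2) by simp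
  finally show "ereal_dist 0 (limiting_subdiff f p) \<le> ereal E + ereal e" .
qed

section \<open>Block coordinates and partially updated vectors\<close>

lemma block_nth [simp]: "block blk i x $ j = (if blk j = i then x $ j else 0)"
  by (simp add: block_def)

lemma splice_nth [simp]:
  "splice blk i a c b $ j = (if blk j < i then a $ j else if blk j = i then c $ j else b $ j)"
  by (simp add: splice_def)

lemma subspace_block_space: "subspace (block_space blk i)"
  by (auto simp: subspace_def block_space_def)

lemma block_in_block_space [simp]: "block blk i x \<in> block_space blk i"
  by (simp add: block_space_def)

lemma bounded_linear_block: "bounded_linear (block blk i)"
  by (simp add: linear_conv_bounded_linear[symmetric] linear_iff vec_eq_iff)

lemmas block_add = linear_add[OF bounded_linear.linear[OF bounded_linear_block]]
  and block_diff = linear_diff[OF bounded_linear.linear[OF bounded_linear_block]]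
  and block_scaleR = linear_scale[OF bounded_linear.linear[OF bounded_linear_block]]

lemma norm_block_le: "norm (block blk i x) \<le> norm x"
  by (rule norm_le_componentwise_cart) auto

lemma inner_block: "block blk i x \<bullet> y = block blk i x \<bullet> block blk i y"
  by (auto simp: inner_vec_def intro!: sum.cong)

lemma inner_block_commute: "block blk i x \<bullet> y = x \<bullet> block blk i y"
  by (auto simp: inner_vec_def intro!: sum.cong)

lemma sum_block:
  assumes "blk ` UNIV = {1..N}"
  shows "(\<Sum>i=1..N. block blk i x) = x"
proof -
  have "(\<Sum>i=1..N. if blk j = i then x $ j else 0) = x $ j" for j
  proof -
    have "blk j \<in> {1..N}" using assms by blast
    then show ?thesis by (subst sum.delta') auto
  qed
  then show ?thesis by (simp add: vec_eq_iff)
qed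

text \<open>Lets whole vectors stand in for their blocks in the partial functions of a
  sweep.\<close>

lemma splice_block: "splice blk i a (block blk i c) b = splice blk i a c b"
  by (simp add: vec_eq_iff)

lemma splice_eq_block_add: "splice blk i a c b = block blk i c + splice blk i a 0 b"
  by (simp add: vec_eq_iff)

text \<open>The telescoping identity of a sweep: block \<open>m + 1\<close> is updated from the
  point reached after block \<open>m\<close>.\<close>

lemma splice_Suc: "splice blk (Suc m) p x x = splice blk m p p x"
  by (auto simp: vec_eq_iff less_Suc_eq)

lemma splice_first:
  assumes "\<And>j. 1 \<le> blk j"
  shows "splice blk 0 p p x = x"
proof -
  have "blk j = 0 \<Longrightarrow> False" for j using assms[of j] by simp
  then show ?thesis unfolding vec_eq_iff splice_nth by (metis less_nat_zero_code)
qed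

lemma splice_last:
  assumes "\<And>j. blk j \<le> N"
  shows "splice blk N p p x = p"
proof -
  have "blk j < N \<or> blk j = N" for j using assms[of j] by auto
  then show ?thesis by (auto simp: vec_eq_iff)
qed

text \<open>In the difference to \<open>p\<close> the blocks below \<open>i\<close> cancel; block
  \<open>i\<close> comes from \<open>y\<close> and the later ones from \<open>x\<close>.\<close>

lemma norm_splice_diff_le: "norm (splice blk i p y x - p) \<le> norm (y - p) + norm (x - p)"
proof -
  have "splice blk i p y x - p = splice blk i 0 (y - p) 0 + splice blk i 0 0 (x - p)"
    by (simp add: vec_eq_iff)
  also have "norm \<dots> \<le> norm (splice blk i 0 (y - p) 0) + norm (splice blk i 0 0 (x - p))"
    by (rule norm_triangle_ineq)
  also have "\<dots> \<le> norm (y - p) + norm (x - p)"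
    by (intro add_mono norm_le_componentwise_cart) auto
  finally show ?thesis .
qed

section \<open>Gradients and scaled inner products\<close>

lemma grad_eqI:
  assumes "GDERIV f x :> D"
  shows "grad f x = D"
  unfolding grad_def
proof (rule the_equality, rule assms)
  fix D' assume "GDERIV f x :> D'"
  with assms have "(\<lambda>h. h \<bullet> D') = (\<lambda>h. h \<bullet> D)"
    unfolding gderiv_def by (rule has_derivative_unique[rotated])
  then have "(D' - D) \<bullet> (D' - D) = 0"
    by (simp add: inner_diff_right fun_eq_iff)
  then show "D' = D" by simp
qed

lemma GDERIV_grad:
  fixes f :: "'a::euclidean_space \<Rightarrow> real"
  assumes "f differentiable (at x)"
  shows "GDERIV f x :> grad f x"
proof -
  obtain f' where f': "(f has_derivative f') (at x)"
    using assms unfolding differentiable_def by blast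
  then have "linear f'" by (rule has_derivative_linear)
  have "f' h = h \<bullet> adjoint f' 1" for h
  proof -
    have "h \<bullet> adjoint f' 1 = f' h \<bullet> 1" by (rule adjoint_works[OF \<open>linear f'\<close>])
    then show ?thesis by (simp only: inner_real_def mult_1_right)
  qed
  then obtain g where g: "\<And>h. f' h = h \<bullet> g" by blast
  then have "f' = (\<lambda>h. h \<bullet> g)" by (rule ext)
  with f' have "GDERIV f x :> g"
    by (simp add: gderiv_def)
  then show ?thesis using grad_eqI[of f x g] by simp
qed

text \<open>The chain rule through an affine map whose linear part is the self-adjoint projection
  onto block \<open>i\<close>: the partial gradient is a block of the full one.\<close>

lemma grad_splice:
  assumes "H differentiable (at (splice blk i a c b))"
  shows "grad (\<lambda>c. H (splice blk i a c b)) c = block blk i (grad H (splice blk i a c b))"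
proof (rule grad_eqI)
  have inner: "((\<lambda>c. splice blk i a c b) has_derivative block blk i) (at c)"
  proof -
    have "(\<lambda>c. splice blk i a c b) = (\<lambda>c. block blk i c + splice blk i a 0 b)"
      by (intro ext splice_eq_block_add)
    then show ?thesis
      using has_derivative_add[OF bounded_linear_imp_has_derivative[OF bounded_linear_block]
          has_derivative_const] by simp
  qed
  have "(H has_derivative (\<lambda>h. h \<bullet> grad H (splice blk i a c b))) (at (splice blk i a c b))"
    using GDERIV_grad[OF assms] by (simp add: gderiv_def)
  from has_derivative_compose[OF inner this]
  show "GDERIV (\<lambda>c. H (splice blk i a c b)) c :> block blk i (grad H (splice blk i a c b))"
    by (simp add: gderiv_def inner_block_commute)
qed

text \<open>Positive definiteness makes \<open>R\<close> injective on \<open>V\<close>, and a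
  dimension count makes it onto. The linear terms of the algorithm pair \<open>R\<close> of the
  scaled gradient with a displacement; cancelling turns this into the Euclidean pairing with the
  gradient.\<close>

lemma spd_on_inverse:
  fixes R :: "'a::euclidean_space \<Rightarrow> 'a"
  assumes V: "subspace V" and R: "spd_on V R" and g: "g \<in> V"
  shows "R (inv_into V R g) = g"
proof -
  have lin: "linear R" and RV: "R ` V \<subseteq> V"
    using R by (auto simp: spd_on_def)
  have inj: "inj_on R V"
  proof (rule inj_onI)
    fix u v assume uv: "u \<in> V" "v \<in> V" "R u = R v"
    then have uv_V: "u - v \<in> V" and "R (u - v) = 0"
      using V lin by (auto simp: subspace_diff linear_diff)
    moreover have "u - v \<noteq> 0 \<longrightarrow> 0 < R (u - v) \<bullet> (u - v)"
      using R uv_V unfolding spd_on_def by blast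
    ultimately show "u = v" by auto
  qed
  have "span V = V" using V by (simp add: span_eq_iff)
  then have "dim (R ` V) = dim V"
    using lin inj dim_image_eq[of R V] by (simp only:)
  then have "R ` V = V"
    using subspace_dim_equal[OF linear_subspace_image[OF lin V] V RV] by simp
  then show ?thesis using g by (metis f_inv_into_f)
qed

section \<open>Comparison of admissible metrics with the Euclidean norm\<close>

text \<open>Equivalence of norms in finite dimension: an orthonormal basis bounds
  \<open>\<nu>\<close> above by a multiple of the norm, so \<open>\<nu>\<close> is Lipschitz on
  \<open>V\<close> and attains a positive minimum on the unit sphere of \<open>V\<close>;
  homogeneity does the rest.\<close>

lemma norm_on_lower_bound:
  fixes V :: "'a::euclidean_space set"
  assumes V: "subspace V" and \<nu>: "norm_on V \<nu>"
  shows "\<exists>c>0. \<forall>u\<in>V. c * norm u \<le> \<nu> u"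
proof -
  have tri: "\<nu> (u + v) \<le> \<nu> u + \<nu> v" if "u \<in> V" "v \<in> V" for u v
    using \<nu> that by (simp add: norm_on_def)
  have hom: "\<nu> (a *\<^sub>R u) = \<bar>a\<bar> * \<nu> u" if "u \<in> V" for u a
    using \<nu> that by (simp add: norm_on_def)
  have ge0: "0 \<le> \<nu> u" if "u \<in> V" for u
    using \<nu> that by (simp add: norm_on_def)
  have pos: "0 < \<nu> u" if "u \<in> V" "u \<noteq> 0" for u
  proof -
    have "0 \<le> \<nu> u \<and> (\<nu> u = 0 \<longleftrightarrow> u = 0)" using \<nu> that(1) by (simp add: norm_on_def)
    then show ?thesis using that(2) by linarith
  qed
  obtain B where B: "B \<subseteq> V" "finite B" "span B = V" "pairwise orthogonal B" "\<And>x. x \<in> B \<Longrightarrow> norm x = 1"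
    using orthonormal_basis_subspace[OF V] by (metis independent_imp_finite)
  define M where "M = (\<Sum>b\<in>B. \<nu> b)"
  have M: "0 \<le> M" using ge0 B(1) by (auto simp: M_def intro!: sum_nonneg)
  have sum_le: "\<nu> (\<Sum>b\<in>A. c b *\<^sub>R b) \<le> (\<Sum>b\<in>A. \<bar>c b\<bar> * \<nu> b)" if "A \<subseteq> B" for A c
    using finite_subset[OF that B(2)] that
  proof (induction A rule: finite_induct)
    case empty
    have "\<nu> 0 = 0" using \<nu> V by (simp add: norm_on_def subspace_0)
    then show ?case by simp
  next
    case (insert b A)
    have "(\<Sum>b\<in>A. c b *\<^sub>R b) \<in> V"
      using insert.prems B(1) V by (intro subspace_sum subspace_scale) auto
    moreover have "b \<in> V" using insert.prems B(1) by auto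
    ultimately show ?case
      using insert tri[of "c b *\<^sub>R b" "\<Sum>b\<in>A. c b *\<^sub>R b"] hom[of b "c b"] V
      by (auto simp: subspace_scale)
  qed
  have upper: "\<nu> u \<le> M * norm u" if "u \<in> V" for u
  proof -
    have "u = (\<Sum>b\<in>B. (u \<bullet> b) *\<^sub>R b)"
      using orthonormal_basis_expand[OF B(4,5) _ B(2), of u] that B(3) by simp
    then have "\<nu> u \<le> (\<Sum>b\<in>B. \<bar>u \<bullet> b\<bar> * \<nu> b)"
      using sum_le[OF order_refl, of "\<lambda>b. u \<bullet> b"] by simp
    also have "\<dots> \<le> (\<Sum>b\<in>B. norm u * \<nu> b)"
    proof (intro sum_mono mult_right_mono)
      fix b assume b: "b \<in> B"
      show "0 \<le> \<nu> b" using b B(1) ge0 by auto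
      show "\<bar>u \<bullet> b\<bar> \<le> norm u"
        using Cauchy_Schwarz_ineq2[of u b] B(5)[OF b] by simp
    qed
    finally show ?thesis by (simp add: M_def sum_distrib_left mult.commute)
  qed
  have diff: "\<bar>\<nu> u - \<nu> v\<bar> \<le> M * dist u v" if "u \<in> V" "v \<in> V" for u v
  proof -
    have "u - v \<in> V" "v - u \<in> V" using that V by (auto simp: subspace_diff)
    then show ?thesis
      using tri[of v "u - v"] tri[of u "v - u"] upper[of "u - v"] upper[of "v - u"] that
      by (simp add: dist_norm norm_minus_commute)
  qed
  have "M-lipschitz_on V \<nu>"
    using diff M by (intro lipschitz_onI) (auto simp: dist_real_def)
  then have cont: "continuous_on V \<nu>" by (rule lipschitz_on_continuous_on)
  define S where "S = sphere 0 1 \<inter> V"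
  have S: "compact S"
    unfolding S_def using closed_subspace[OF V] by (intro compact_Int_closed) auto
  show ?thesis
  proof (cases "S = {}")
    \<comment> \<open>An empty unit sphere means \<open>V = {0}\<close>, where any positive constant
      works.\<close>
    case True
    have "u = 0" if "u \<in> V" for u
    proof (rule ccontr)
      assume "u \<noteq> 0"
      then have "(1 / norm u) *\<^sub>R u \<in> S"
        using that V by (auto simp: S_def subspace_scale)
      with True show False by simp
    qed
    then show ?thesis using ge0 by (intro exI[of _ 1]) force
  next
    case False
    obtain m where m: "m \<in> S" "\<And>u. u \<in> S \<Longrightarrow> \<nu> m \<le> \<nu> u"
      using continuous_attains_inf[OF S False continuous_on_subset[OF cont]] by (auto simp: S_def)
    have "\<nu> m * norm u \<le> \<nu> u" if "u \<in> V" for u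
    proof (cases "u = 0")
      case True
      then show ?thesis using ge0 that by simp
    next
      case False
      then have "(1 / norm u) *\<^sub>R u \<in> S"
        using that V by (auto simp: S_def subspace_scale)
      from m(2)[OF this] hom[OF that, of "1 / norm u"] show ?thesis
        using False by (simp add: pos_le_divide_eq)
    qed
    moreover have "0 < \<nu> m"
    proof -
      have "m \<in> V" "norm m = 1" using m(1) by (auto simp: S_def)
      moreover from this have "m \<noteq> 0" by fastforce
      ultimately show ?thesis using pos[of m] by simp
    qed
    ultimately show ?thesis by blast
  qed
qed

lemma admissible_metrics_lower_bound:
  fixes V :: "'a::euclidean_space set"
  assumes V: "subspace V" and D: "admissible_metrics V D"
  shows "\<exists>c>0. \<forall>d\<in>D. \<forall>x\<in>V. \<forall>y\<in>V. c * norm (x - y) \<le> d x y"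
proof -
  obtain \<nu> c where c: "c > 0" "norm_on V \<nu>" "\<And>d x y. d\<in>D \<Longrightarrow> x\<in>V \<Longrightarrow> y\<in>V \<Longrightarrow> c * \<nu> (x - y) \<le> d x y"
    using D unfolding admissible_metrics_def by metis
  obtain c' where c': "c' > 0" "\<And>u. u \<in> V \<Longrightarrow> c' * norm u \<le> \<nu> u"
    using norm_on_lower_bound[OF V c(2)] by auto
  have "c * c' * norm (x - y) \<le> d x y" if "d \<in> D" "x \<in> V" "y \<in> V" for d x y
  proof -
    have "c * (c' * norm (x - y)) \<le> c * \<nu> (x - y)"
      using c(1) c'(2)[of "x - y"] that V by (simp add: subspace_diff)
    also have "\<dots> \<le> d x y" using c(3) that by simp
    finally show ?thesis by (simp add: mult.assoc)
  qed
  then show ?thesis using c(1) c'(1) by (intro exI[of _ "c * c'"]) auto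
qed

text \<open>
  Convexity of \<open>d(\<cdot>, y)\<close> along the ray from \<open>y\<close> through \<open>x\<close> turns the bound on
  compact sets into a Lipschitz-type bound.
\<close>

lemma admissible_metrics_upper_bound:
  fixes V :: "'a::euclidean_space set"
  assumes V: "subspace V" and D: "admissible_metrics V D"
  shows "\<exists>M>0. \<forall>d\<in>D. \<forall>x\<in>V. \<forall>y\<in>V. norm x \<le> B \<longrightarrow> norm y \<le> B \<longrightarrow> d x y \<le> M * norm (x - y)"
proof -
  \<comment> \<open>The radius is \<open>B + 1\<close> because the ray is followed to a point
    \<open>v\<close> at distance 1 from \<open>y\<close>, which may leave the ball of radius
    \<open>B\<close>.\<close>
  define K where "K = (cball 0 (B + 1) \<inter> V) \<times> (cball 0 (B + 1) \<inter> V)"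
  have "compact K"
    unfolding K_def using closed_subspace[OF V] by (intro compact_Times compact_Int_closed) auto
  moreover have "K \<subseteq> V \<times> V" by (auto simp: K_def)
  ultimately obtain M where M: "\<forall>(x, y)\<in>K. (SUP d\<in>D. ereal (d x y)) \<le> ereal M"
    using D unfolding admissible_metrics_def by metis
  have bound: "d x y \<le> M" if "d \<in> D" "(x, y) \<in> K" for d x y
  proof -
    have "ereal (d x y) \<le> (SUP d\<in>D. ereal (d x y))"
      using that(1) by (intro SUP_upper)
    also have "\<dots> \<le> ereal M" using M that(2) by auto
    finally show ?thesis by simp
  qed
  have "d x y \<le> max M 1 * norm (x - y)"
    if d: "d \<in> D" and xy: "x \<in> V" "y \<in> V" "norm x \<le> B" "norm y \<le> B" for d x y
  proof -
    interpret Metric_space V d using D d by (simp add: admissible_metrics_def)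
    define t where "t = norm (x - y)"
    \<comment> \<open>Only short distances call for convexity; from distance 1 on, the bound
      \<open>M\<close> on the compact set is already at most \<open>max M 1\<close> times the
      distance.\<close>
    consider "t = 0" | "1 \<le> t" | "0 < t" "t < 1"
      using norm_ge_zero[of "x - y"] unfolding t_def by linarith
    then show ?thesis
    proof cases
      case 1
      then show ?thesis using xy by (simp add: t_def)
    next
      case 2
      have "d x y \<le> max M 1 * 1"
        using bound[OF d, of x y] xy by (simp add: K_def)
      also have "\<dots> \<le> max M 1 * norm (x - y)"
        using 2 by (intro mult_left_mono) (auto simp: t_def)
      finally show ?thesis .
    next
      case 3
      define v where "v = y + (1 / t) *\<^sub>R (x - y)"
      have v: "v \<in> V" using xy V by (simp add: v_def subspace_add subspace_diff subspace_scale)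
      have "norm v \<le> norm y + norm ((1 / t) *\<^sub>R (x - y))"
        unfolding v_def by (rule norm_triangle_ineq)
      also have "norm ((1 / t) *\<^sub>R (x - y)) = 1"
        using 3 by (simp add: t_def)
      finally have vK: "(v, y) \<in> K" using xy v by (simp add: K_def)
      have "x = (1 - t) *\<^sub>R y + t *\<^sub>R v"
        using 3 by (simp add: v_def algebra_simps)
      moreover have "convex_on V (\<lambda>x. d x y)"
        using D d xy by (simp add: admissible_metrics_def)
      ultimately have "d x y \<le> (1 - t) * d y y + t * d v y"
        using convex_onD[of V "\<lambda>x. d x y" t y v] 3 xy v by simp
      also have "\<dots> = t * d v y" using xy by simp
      also have "\<dots> \<le> t * max M 1"
        using bound[OF d vK] 3 by (intro mult_left_mono) auto
      finally show ?thesis by (simp add: t_def mult.commute)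
    qed
  qed
  then show ?thesis by (intro exI[of _ "max M 1"]) auto
qed

lemma sum_norm_block_squared:
  assumes "blk ` UNIV = {1..N}"
  shows "(\<Sum>i=1..N. (norm (block blk i x))\<^sup>2) = (norm x)\<^sup>2"
proof -
  have "(\<Sum>i=1..N. (norm (block blk i x))\<^sup>2) = (\<Sum>i=1..N. block blk i x \<bullet> x)"
    by (intro sum.cong refl) (simp add: inner_block[of blk _ x x] power2_norm_eq_inner)
  also have "\<dots> = (norm x)\<^sup>2"
    by (simp add: sum_block[OF assms] power2_norm_eq_inner del: One_nat_def flip: inner_sum_left)
  finally show ?thesis .
qed

text \<open>By the mean value theorem the increment of \<open>H\<close> is the pairing of
  \<open>w - p\<close> with the gradient at a point of the segment; moving that gradient to
  \<open>p\<close> changes it by at most \<open>L * norm (w - p)\<close>.\<close>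

lemma lipschitz_grad_lower_bound:
  fixes H :: "'a::euclidean_space \<Rightarrow> real"
  assumes diff: "\<And>x. H differentiable (at x)" and S: "convex S" and L: "L-lipschitz_on S (grad H)"
    and p: "p \<in> S" and w: "w \<in> S"
  shows "H p + grad H p \<bullet> (w - p) \<le> H w + L * (norm (w - p))\<^sup>2"
proof -
  define \<phi> where "\<phi> t = H (p + t *\<^sub>R (w - p))" for t :: real
  have der: "(\<phi> has_real_derivative (w - p) \<bullet> grad H (p + t *\<^sub>R (w - p))) (at t)" for t
  proof -
    have "((\<lambda>t. p + t *\<^sub>R (w - p)) has_derivative (\<lambda>h. h *\<^sub>R (w - p))) (at t)"
      by (auto intro!: derivative_eq_intros)
    moreover have "(H has_derivative (\<lambda>h. h \<bullet> grad H (p + t *\<^sub>R (w - p)))) (at (p + t *\<^sub>R (w - p)))"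
      using GDERIV_grad[OF diff] by (simp add: gderiv_def)
    ultimately have "(\<phi> has_derivative (\<lambda>h. (h *\<^sub>R (w - p)) \<bullet> grad H (p + t *\<^sub>R (w - p)))) (at t)"
      unfolding \<phi>_def[abs_def] by (rule has_derivative_compose)
    then show ?thesis
      by (simp add: has_field_derivative_def mult.commute[of _ "(w - p) \<bullet> _"])
  qed
  obtain t where t: "0 < t" "t < 1"
    and eq: "\<phi> 1 - \<phi> 0 = (1 - 0) * ((w - p) \<bullet> grad H (p + t *\<^sub>R (w - p)))"
    using MVT2[of 0 1 \<phi> "\<lambda>t. (w - p) \<bullet> grad H (p + t *\<^sub>R (w - p))"] der by auto
  define \<xi> where "\<xi> = p + t *\<^sub>R (w - p)"
  have "\<xi> = (1 - t) *\<^sub>R p + t *\<^sub>R w" by (simp add: \<xi>_def algebra_simps)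
  then have \<xi>: "\<xi> \<in> S" using S p w t by (simp add: convexD)
  have "norm (grad H p - grad H \<xi>) \<le> L * norm (p - \<xi>)"
    using lipschitz_onD[OF L p \<xi>] by (simp add: dist_norm)
  also have "norm (p - \<xi>) = t * norm (w - p)" using t by (simp add: \<xi>_def)
  also have "L * (t * norm (w - p)) \<le> L * norm (w - p)"
    using t lipschitz_on_nonneg[OF L] by (intro mult_left_mono) (auto simp: mult_left_le_one_le)
  finally have "norm (w - p) * norm (grad H p - grad H \<xi>) \<le> norm (w - p) * (L * norm (w - p))"
    by (intro mult_left_mono) auto
  moreover have "(w - p) \<bullet> (grad H p - grad H \<xi>) \<le> norm (w - p) * norm (grad H p - grad H \<xi>)"
    by (rule norm_cauchy_schwarz)
  moreover have "H w - H p = (w - p) \<bullet> grad H \<xi>"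
    using eq by (simp add: \<phi>_def \<xi>_def)
  ultimately show ?thesis
    by (simp add: inner_diff_right inner_commute[of "grad H p"] power2_eq_square algebra_simps)
qed

section \<open>One sweep over the blocks\<close>

locale block_problem =
  fixes blk :: "'n::finite \<Rightarrow> nat" and N :: nat
    and H :: "real^'n \<Rightarrow> real" and F :: "nat \<Rightarrow> real^'n \<Rightarrow> ereal"
    and D :: "nat \<Rightarrow> (real^'n \<Rightarrow> real^'n \<Rightarrow> real) set"
  assumes blocks: "blk ` UNIV = {1..N}"
    and smooth: "smooth_coupling blk N H"
    and terms: "admissible_terms blk N F"
    and metrics: "\<And>i. i \<in> {1..N} \<Longrightarrow> admissible_metrics (block_space blk i) (D i)"
begin

abbreviation "J \<equiv> objective blk N H F"

lemma differentiable: "H differentiable (at x)"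
  using smooth by (simp add: smooth_coupling_def)

lemma Metric_space_metric: "i \<in> {1..N} \<Longrightarrow> d \<in> D i \<Longrightarrow> Metric_space (block_space blk i) d"
  using metrics by (simp add: admissible_metrics_def)

lemma term_not_MInf: "i \<in> {1..N} \<Longrightarrow> F i (block blk i x) \<noteq> -\<infinity>"
  using terms by (simp add: admissible_terms_def proper_on_def)

lemma lsc_sum_terms:
  "lsc_on UNIV (\<lambda>x. \<Sum>i=1..N. F i (block blk i x)) \<and> (\<forall>x. (\<Sum>i=1..N. F i (block blk i x)) \<noteq> -\<infinity>)"
proof (intro lsc_on_UNIV_sum)
  fix i assume i: "i \<in> {1..N}"
  have "lsc_on (block_space blk i) (F i)"
    using terms i by (simp add: admissible_terms_def)
  then show "lsc_on UNIV (\<lambda>x. F i (block blk i x))"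
    by (rule lsc_on_UNIV_compose)
      (auto intro: linear_continuous_on bounded_linear_block)
qed (use term_not_MInf in auto)

lemma lsc_objective: "lsc_on UNIV J"
proof -
  have "continuous_on UNIV H"
    using differentiable by (meson differentiable_imp_continuous_within continuous_at_imp_continuous_on)
  then have "lsc_on UNIV (\<lambda>x. ereal (H x) + (\<Sum>i=1..N. F i (block blk i x)))"
    using lsc_sum_terms by (intro lsc_on_UNIV_add lsc_on_UNIV_continuous) auto
  then show ?thesis by (simp add: objective_def[abs_def])
qed

lemma objective_not_MInf: "J x \<noteq> -\<infinity>"
  using lsc_sum_terms by (simp add: objective_def)

lemma objective_finite:
  assumes "J x \<noteq> \<infinity>"
  obtains f where "\<And>i. i \<in> {1..N} \<Longrightarrow> F i (block blk i x) = ereal (f i)"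
    and "J x = ereal (H x + (\<Sum>i=1..N. f i))"
proof -
  have "(\<Sum>i=1..N. F i (block blk i x)) \<noteq> \<infinity>"
    using assms by (auto simp: objective_def)
  then have "F i (block blk i x) \<noteq> \<infinity>" if "i \<in> {1..N}" for i
    using that by (auto simp: sum_Pinfty)
  then have eq: "F i (block blk i x) = ereal (real_of_ereal (F i (block blk i x)))" if "i \<in> {1..N}" for i
    using that term_not_MInf[OF that, of x] by (auto simp: ereal_real)
  then have "(\<Sum>i=1..N. F i (block blk i x)) = (\<Sum>i=1..N. ereal (real_of_ereal (F i (block blk i x))))"
    by (rule sum.cong[OF refl])
  then have "J x = ereal (H x + (\<Sum>i=1..N. real_of_ereal (F i (block blk i x))))"
    unfolding objective_def by (simp only: sum_ereal plus_ereal.simps)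
  with eq show ?thesis by (rule that)
qed

text \<open>A sweep in Euclidean terms: \<open>R\<close> is cancelled against its inverse, the
  extrapolated blocks are assembled into one vector \<open>y\<close>, and partial gradients become
  blocks of \<open>grad H\<close>.\<close>

lemma ggbpl_passD:
  assumes pass: "ggbpl_pass blk N H F D \<beta> x' x ch p" and i: "i \<in> {1..N}"
  defines "y \<equiv> x + \<beta> *\<^sub>R (x - x')"
  shows "metric (ch i) \<in> D i" "0 < Lconst (ch i)" "Lconst (ch i) < sparam (ch i)" "1 < gparam (ch i)"
    and "\<And>u v. u \<in> block_space blk i \<Longrightarrow> v \<in> block_space blk i \<Longrightarrow>
      H (splice blk i p v x) \<le> H (splice blk i p u x)
        + block blk i (grad H (splice blk i p u x)) \<bullet> (v - u) + Lconst (ch i) / 2 * (metric (ch i) v u)\<^sup>2"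
    and "\<And>w. w \<in> block_space blk i \<Longrightarrow>
      F i (block blk i p) + ereal (1 / (2 * step_size (ch i)) * (metric (ch i) (block blk i p) (block blk i y))\<^sup>2
        + block blk i (grad H (splice blk i p y x)) \<bullet> (block blk i p - block blk i y))
      \<le> F i w + ereal (1 / (2 * step_size (ch i)) * (metric (ch i) w (block blk i y))\<^sup>2
        + block blk i (grad H (splice blk i p y x)) \<bullet> (w - block blk i y))"
proof -
  have y: "block blk i x + \<beta> *\<^sub>R (block blk i x - block blk i x') = block blk i y"
    by (simp add: y_def block_add block_diff block_scaleR)
  let ?V = "block_space blk i" and ?R = "scaling (ch i)"
  let ?h = "\<lambda>c. H (splice blk i p c x)"
  note P = pass[unfolded ggbpl_pass_def Let_def, rule_format, OF i, unfolded y]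
  have grad: "?R (inv_into ?V ?R (grad ?h u)) = block blk i (grad H (splice blk i p u x))" for u
  proof -
    have "spd_on ?V ?R" using P by blast
    moreover have "grad ?h u = block blk i (grad H (splice blk i p u x))"
      by (rule grad_splice[OF differentiable])
    ultimately show ?thesis
      using spd_on_inverse[OF subspace_block_space, of blk i ?R "grad ?h u"] by simp
  qed
  show "metric (ch i) \<in> D i" "0 < Lconst (ch i)" "Lconst (ch i) < sparam (ch i)" "1 < gparam (ch i)"
    using P by auto
  show "H (splice blk i p v x) \<le> H (splice blk i p u x)
        + block blk i (grad H (splice blk i p u x)) \<bullet> (v - u) + Lconst (ch i) / 2 * (metric (ch i) v u)\<^sup>2"
    if "u \<in> ?V" "v \<in> ?V" for u v
  proof -
    have "H (splice blk i p v x) \<le> H (splice blk i p u x)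
        + ?R (inv_into ?V ?R (grad ?h u)) \<bullet> (v - u) + Lconst (ch i) / 2 * (metric (ch i) v u)\<^sup>2"
      using P that by blast
    then show ?thesis by (simp only: grad)
  qed
  fix w assume w: "w \<in> ?V"
  have "grad ?h (block blk i y) = grad ?h y"
    by (simp add: grad_splice[OF differentiable] splice_block)
  then have g: "?R (inv_into ?V ?R (grad ?h (block blk i y))) = block blk i (grad H (splice blk i p y x))"
    using grad[of y] by simp
  from P have "is_arg_min (\<lambda>w. F i w + ereal (1 / (2 * step_size (ch i)) * (metric (ch i) w (block blk i y))\<^sup>2
       + ?R (inv_into ?V ?R (grad ?h (block blk i y))) \<bullet> (w - block blk i y))) (\<lambda>w. w \<in> ?V) (block blk i p)"
    by blast
  then show "F i (block blk i p) + ereal (1 / (2 * step_size (ch i)) * (metric (ch i) (block blk i p) (block blk i y))\<^sup>2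
        + block blk i (grad H (splice blk i p y x)) \<bullet> (block blk i p - block blk i y))
      \<le> F i w + ereal (1 / (2 * step_size (ch i)) * (metric (ch i) w (block blk i y))\<^sup>2
        + block blk i (grad H (splice blk i p y x)) \<bullet> (w - block blk i y))"
    using w unfolding g is_arg_min_linorder by blast
qed


text \<open>Without extrapolation \<open>y = x\<close>, so the subproblem at block \<open>i\<close>
  of \<open>x\<close> has just the value of \<open>F i\<close>. Minimality gains
  \<open>gparam * sparam / 2\<close> times the squared metric, the upper model of \<open>H\<close>
  loses \<open>Lconst / 2\<close> times it, and \<open>Lconst < sparam\<close> leaves
  \<open>(gparam - 1) * sparam / 2\<close>.\<close>

lemma pass_objective_decrease:
  assumes pass: "ggbpl_pass blk N H F D 0 x' x ch p" and fin: "J x \<noteq> \<infinity>"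
  shows "J p + ereal (\<Sum>i=1..N. (gparam (ch i) - 1) * sparam (ch i) / 2
      * (metric (ch i) (block blk i p) (block blk i x))\<^sup>2) \<le> J x"
proof -
  obtain f where f: "\<And>i. i \<in> {1..N} \<Longrightarrow> F i (block blk i x) = ereal (f i)"
    and Jx: "J x = ereal (H x + (\<Sum>i=1..N. f i))"
    using objective_finite[OF fin] by blast
  \<comment> \<open>\<open>S m\<close> is \<open>H\<close> after the first \<open>m\<close> blocks
    have been updated, running from \<open>S 0 = H x\<close> to \<open>S N = H p\<close>.\<close>
  define S where "S m = H (splice blk m p p x)" for m
  define dd where "dd i = (metric (ch i) (block blk i p) (block blk i x))\<^sup>2" for i
  define \<kappa> where "\<kappa> i = (gparam (ch i) - 1) * sparam (ch i) / 2" for i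
  have step: "\<exists>g. F i (block blk i p) = ereal g \<and> g + S i + \<kappa> i * dd i \<le> f i + S (i - 1)"
    if i: "i \<in> {1..N}" for i
  proof -
    note P = ggbpl_passD[OF pass i]
    interpret Metric_space "block_space blk i" "metric (ch i)"
      using Metric_space_metric[OF i P(1)] .
    define a where "a = block blk i (grad H (splice blk i p x x)) \<bullet> (block blk i p - block blk i x)"
    define t where "t = 1 / (2 * step_size (ch i))"
    have t: "t = gparam (ch i) * sparam (ch i) / 2"
      by (simp add: t_def step_size_def)
    have "F i (block blk i p) + ereal (t * dd i + a) \<le> F i (block blk i x) + ereal 0"
      using P(6)[of "block blk i x"] by (simp add: a_def t_def dd_def)
    then have "F i (block blk i p) + ereal (t * dd i + a) \<le> ereal (f i)"
      using f[OF i] by simp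
    then obtain g where g: "F i (block blk i p) = ereal g" "g + (t * dd i + a) \<le> f i"
      using term_not_MInf[OF i, of p] by (cases "F i (block blk i p)") auto
    have "splice blk i p x x = splice blk (i - 1) p p x"
      using splice_Suc[of blk "i - 1" p x] i by simp
    then have "S i \<le> S (i - 1) + a + Lconst (ch i) / 2 * dd i"
      using P(5)[of "block blk i x" "block blk i p"]
      by (simp add: S_def a_def dd_def splice_block)
    moreover have "\<kappa> i * dd i + Lconst (ch i) / 2 * dd i \<le> t * dd i"
    proof -
      have "\<kappa> i + Lconst (ch i) / 2 \<le> t"
        using P(3) by (simp add: \<kappa>_def t field_simps)
      then have "(\<kappa> i + Lconst (ch i) / 2) * dd i \<le> t * dd i"
        by (intro mult_right_mono) (auto simp: dd_def)
      then show ?thesis by (simp add: distrib_right)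
    qed
    ultimately show ?thesis using g by (intro exI[of _ g]) auto
  qed
  then obtain g where g: "\<And>i. i \<in> {1..N} \<Longrightarrow> F i (block blk i p) = ereal (g i)"
    and g_le: "\<And>i. i \<in> {1..N} \<Longrightarrow> g i + S i + \<kappa> i * dd i \<le> f i + S (i - 1)"
    by metis
  have "(\<Sum>i=1..m. g i) + (\<Sum>i=1..m. \<kappa> i * dd i) + S m \<le> (\<Sum>i=1..m. f i) + S 0" if "m \<le> N" for m
    using that
  proof (induction m)
    case (Suc m)
    then show ?case using g_le[of "Suc m"] by simp
  qed simp
  moreover have "1 \<le> blk j" "blk j \<le> N" for j
    using blocks by (metis atLeastAtMost_iff rangeI)+
  then have "S N = H p" "S 0 = H x"
    by (simp_all add: S_def splice_first splice_last)
  ultimately have real_le: "(\<Sum>i=1..N. g i) + (\<Sum>i=1..N. \<kappa> i * dd i) + H p \<le> (\<Sum>i=1..N. f i) + H x"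
    by (metis order_refl)
  have "J p = ereal (H p) + (\<Sum>i=1..N. ereal (g i))"
    unfolding objective_def by (intro arg_cong2[where f = "(+)"] sum.cong refl g)
  then have "J p = ereal (H p + (\<Sum>i=1..N. g i))"
    by (simp only: sum_ereal plus_ereal.simps)
  then show ?thesis
    using Jx real_le by (simp add: \<kappa>_def dd_def)
qed

text \<open>The subproblem is compared at block \<open>i\<close> of \<open>p\<close> and of
  \<open>w\<close>. What is linear in \<open>e\<close> must be the pairing with
  \<open>grad H p\<close>, which recombines with \<open>H\<close> when the blocks are summed, or
  else carry the factor \<open>a\<close>; a quadratic remainder is allowed. The radius
  \<open>3 * B\<close> holds the extrapolated point, and \<open>7 * B\<close> the point where the
  partial gradient is taken.\<close>

lemma pass_block_estimate:
  assumes pass: "ggbpl_pass blk N H F D \<beta> x' x ch p" and i: "i \<in> {1..N}"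
    and \<beta>: "0 \<le> \<beta>" "\<beta> \<le> 1" and \<sigma>: "0 < \<sigma>" "\<sigma> \<le> step_size (ch i)"
    and B: "norm x' \<le> B" "norm x \<le> B" "norm p \<le> B" "norm w \<le> B"
    and M: "0 \<le> M"
      "\<And>u v. u \<in> block_space blk i \<Longrightarrow> v \<in> block_space blk i \<Longrightarrow> norm u \<le> 3 * B \<Longrightarrow> norm v \<le> 3 * B \<Longrightarrow>
        metric (ch i) u v \<le> M * norm (u - v)"
    and L: "L-lipschitz_on (cball 0 (7 * B)) (grad H)"
  defines "K \<equiv> M\<^sup>2 / \<sigma> + 2 * L" and "a \<equiv> norm (p - x) + norm (x - x')" and "e \<equiv> norm (w - p)"
  shows "F i (block blk i p)
    \<le> F i (block blk i w) + ereal (block blk i (grad H p) \<bullet> (w - p) + K * a * e + K * e\<^sup>2)"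
proof -
  note P = ggbpl_passD[OF pass i]
  interpret Metric_space "block_space blk i" "metric (ch i)"
    using Metric_space_metric[OF i P(1)] .
  have B0: "0 \<le> B" using B(1) norm_ge_zero order_trans by blast
  have L0: "0 \<le> L" using L by (rule lipschitz_on_nonneg)
  have a0: "0 \<le> a" and e0: "0 \<le> e" by (simp_all add: a_def e_def)
  define y where "y = x + \<beta> *\<^sub>R (x - x')"
  define G where "G = grad H (splice blk i p y x)"
  define d1 where "d1 = metric (ch i) (block blk i w) (block blk i y)"
  define d2 where "d2 = metric (ch i) (block blk i p) (block blk i y)"
  have yx: "norm (y - x) \<le> norm (x - x')"
    using \<beta> by (simp add: y_def mult_left_le_one_le)
  have "norm (x - x') \<le> 2 * B"
    using norm_triangle_ineq4[of x x'] B by simp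
  then have y_bound: "norm y \<le> 3 * B"
    using norm_triangle_sub[of y x] yx B by simp
  have yp: "norm (y - p) \<le> a"
    using norm_triangle_ineq[of "y - x" "x - p"] yx by (simp add: a_def norm_minus_commute)
  have le3: "norm (block blk i u) \<le> 3 * B" if "norm u \<le> 3 * B" for u
    using norm_block_le[of blk i u] that by simp
  have wB: "norm w \<le> 3 * B" and pB: "norm p \<le> 3 * B" using B B0 by auto
  have d2: "0 \<le> d2" "d2 \<le> M * a"
  proof -
    show "0 \<le> d2" by (simp add: d2_def)
    have "d2 \<le> M * norm (block blk i p - block blk i y)"
      unfolding d2_def by (intro M(2) le3 y_bound pB) auto
    also have "\<dots> \<le> M * a"
      using M(1) norm_block_le[of blk i "p - y"] yp
      by (intro mult_left_mono) (auto simp: block_diff norm_minus_commute)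
    finally show "d2 \<le> M * a" .
  qed
  have d1: "d1 \<le> M * e + d2"
  proof -
    have "d1 \<le> metric (ch i) (block blk i w) (block blk i p) + d2"
      unfolding d1_def d2_def by (intro triangle) auto
    also have "metric (ch i) (block blk i w) (block blk i p) \<le> M * norm (block blk i w - block blk i p)"
      by (intro M(2) le3 wB pB) auto
    also have "\<dots> \<le> M * e"
      using M(1) norm_block_le[of blk i "w - p"]
      by (intro mult_left_mono) (auto simp: block_diff e_def)
    finally show ?thesis by simp
  qed
  \<comment> \<open>Expanding the square isolates the cross term \<open>2 * (M * e) * d2\<close>, in
    which \<open>d2 \<le> M * a\<close> brings in the step lengths.\<close>
  have "d1\<^sup>2 \<le> (M * e + d2)\<^sup>2"
    using d1 by (intro power_mono) (auto simp: d1_def)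
  then have "d1\<^sup>2 - d2\<^sup>2 \<le> 2 * (M * e) * d2 + (M * e)\<^sup>2"
    by (simp add: power2_sum)
  also have "2 * (M * e) * d2 \<le> 2 * (M * e) * (M * a)"
    using d2 M(1) e0 by (intro mult_left_mono) auto
  finally have sq: "d1\<^sup>2 - d2\<^sup>2 \<le> 2 * M\<^sup>2 * (a * e + e\<^sup>2)"
    using zero_le_power2[of "M * e"] by (simp add: power2_eq_square algebra_simps)
  define t where "t = 1 / (2 * step_size (ch i))"
  have t: "0 \<le> t" "t \<le> 1 / (2 * \<sigma>)"
    using \<sigma> by (auto simp: t_def intro!: divide_left_mono)
  have "t * (d1\<^sup>2 - d2\<^sup>2) \<le> t * (2 * M\<^sup>2 * (a * e + e\<^sup>2))"
    using sq t(1) by (rule mult_left_mono)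
  also have "\<dots> \<le> 1 / (2 * \<sigma>) * (2 * M\<^sup>2 * (a * e + e\<^sup>2))"
    using t(2) a0 e0 by (intro mult_right_mono) auto
  also have "\<dots> = M\<^sup>2 / \<sigma> * (a * e + e\<^sup>2)"
    using \<sigma> by simp
  finally have metric_part: "t * d1\<^sup>2 - t * d2\<^sup>2 \<le> M\<^sup>2 / \<sigma> * (a * e + e\<^sup>2)"
    by (simp add: right_diff_distrib)
  \<comment> \<open>The point defining \<open>G\<close> agrees with \<open>p\<close> below block
    \<open>i\<close>, and both \<open>y\<close> and \<open>x\<close> are within \<open>a\<close> of
    \<open>p\<close>; hence the total displacement \<open>2 * a\<close>.\<close>
  have grad_part: "block blk i G \<bullet> (w - p) \<le> block blk i (grad H p) \<bullet> (w - p) + 2 * L * a * e"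
  proof -
    have "norm (x - p) \<le> a" by (simp add: a_def norm_minus_commute)
    with yp have diff: "norm (splice blk i p y x - p) \<le> 2 * a"
      using norm_splice_diff_le[of blk i p y x] by simp
    have "norm (splice blk i p y x - p) \<le> norm (y - p) + norm (x - p)"
      by (rule norm_splice_diff_le)
    also have "\<dots> \<le> 6 * B"
      using norm_triangle_ineq4[of y p] norm_triangle_ineq4[of x p] y_bound B by simp
    finally have "norm (splice blk i p y x) \<le> 7 * B"
      using norm_triangle_sub[of "splice blk i p y x" p] B by simp
    moreover have "norm p \<le> 7 * B" using B(3) B0 by simp
    ultimately have "norm (G - grad H p) \<le> L * norm (splice blk i p y x - p)"
      using lipschitz_onD[OF L] by (simp add: G_def dist_norm)
    also have "\<dots> \<le> L * (2 * a)" using diff L0 by (intro mult_left_mono) auto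
    finally have "norm (block blk i (G - grad H p)) \<le> 2 * L * a"
      using norm_block_le[of blk i "G - grad H p"] by simp
    then have "block blk i (G - grad H p) \<bullet> (w - p) \<le> 2 * L * a * e"
      using norm_cauchy_schwarz[of "block blk i (G - grad H p)" "w - p"] e0
      by (smt (verit, best) e_def mult_right_mono)
    then show ?thesis by (simp add: block_diff inner_diff_left)
  qed
  have total: "t * d1\<^sup>2 + block blk i G \<bullet> (block blk i w - block blk i y)
      - (t * d2\<^sup>2 + block blk i G \<bullet> (block blk i p - block blk i y))
      \<le> block blk i (grad H p) \<bullet> (w - p) + K * a * e + K * e\<^sup>2"
  proof -
    have "block blk i G \<bullet> (block blk i w - block blk i y) - block blk i G \<bullet> (block blk i p - block blk i y)
        = block blk i G \<bullet> (w - p)"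
      by (simp add: inner_block[of blk i G w] inner_block[of blk i G p] inner_diff_right)
    moreover have "K * a * e + K * e\<^sup>2 = M\<^sup>2 / \<sigma> * (a * e + e\<^sup>2) + 2 * L * a * e + 2 * L * e\<^sup>2"
      by (simp add: K_def algebra_simps)
    moreover have "0 \<le> 2 * L * e\<^sup>2" using L0 by simp
    ultimately show ?thesis using metric_part grad_part by linarith
  qed
  have min: "F i (block blk i p) + ereal (t * d2\<^sup>2 + block blk i G \<bullet> (block blk i p - block blk i y))
      \<le> F i (block blk i w) + ereal (t * d1\<^sup>2 + block blk i G \<bullet> (block blk i w - block blk i y))"
    using P(6)[of "block blk i w"] unfolding t_def d1_def d2_def G_def y_def by simp
  show ?thesis
    using min total term_not_MInf[OF i, of p] term_not_MInf[OF i, of w]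
    by (cases "F i (block blk i p)"; cases "F i (block blk i w)") auto
qed

text \<open>Summing the block estimates assembles the full pairing of \<open>grad H p\<close> with
  \<open>w - p\<close>, which the Lipschitz gradient turns into \<open>H w - H p\<close> up to a
  quadratic error. \<open>K\<close> is chosen before the pass, its parameters and \<open>w\<close>,
  so one constant serves all iterates.\<close>

lemma pass_objective_estimate:
  assumes B: "0 \<le> B" and \<sigma>: "0 < \<sigma>"
  shows "\<exists>K\<ge>0. \<forall>\<beta> x' x ch p w. ggbpl_pass blk N H F D \<beta> x' x ch p \<longrightarrow> 0 \<le> \<beta> \<longrightarrow> \<beta> \<le> 1 \<longrightarrow>
    (\<forall>i\<in>{1..N}. \<sigma> \<le> step_size (ch i)) \<longrightarrow>
    norm x' \<le> B \<longrightarrow> norm x \<le> B \<longrightarrow> norm p \<le> B \<longrightarrow> norm w \<le> B \<longrightarrow>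
    J p \<le> J w + ereal (K * (norm (p - x) + norm (x - x')) * norm (w - p) + K * (norm (w - p))\<^sup>2)"
proof -
  have "\<forall>i\<in>{1..N}. \<exists>M>0. \<forall>d\<in>D i. \<forall>u\<in>block_space blk i. \<forall>v\<in>block_space blk i.
      norm u \<le> 3 * B \<longrightarrow> norm v \<le> 3 * B \<longrightarrow> d u v \<le> M * norm (u - v)"
    using admissible_metrics_upper_bound[OF subspace_block_space metrics] by blast
  then obtain M where M: "\<And>i. i \<in> {1..N} \<Longrightarrow> 0 < M i"
    "\<And>i d u v. i \<in> {1..N} \<Longrightarrow> d \<in> D i \<Longrightarrow> u \<in> block_space blk i \<Longrightarrow> v \<in> block_space blk i \<Longrightarrow>
      norm u \<le> 3 * B \<Longrightarrow> norm v \<le> 3 * B \<Longrightarrow> d u v \<le> M i * norm (u - v)"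
    by metis
  obtain L where L: "L-lipschitz_on (cball 0 (7 * B)) (grad H)"
    using smooth unfolding smooth_coupling_def by (meson bounded_cball)
  then have L0: "0 \<le> L" by (rule lipschitz_on_nonneg)
  \<comment> \<open>The final \<open>L\<close> pays for the quadratic error of \<open>H\<close>; the
    linear term it also produces is nonnegative slack.\<close>
  define K where "K = (\<Sum>i=1..N. (M i)\<^sup>2 / \<sigma> + 2 * L) + L"
  have K0: "0 \<le> K" using \<sigma> L0 by (auto simp: K_def intro!: add_nonneg_nonneg sum_nonneg)
  have "J p \<le> J w + ereal (K * (norm (p - x) + norm (x - x')) * norm (w - p) + K * (norm (w - p))\<^sup>2)"
    if pass: "ggbpl_pass blk N H F D \<beta> x' x ch p" and \<beta>: "0 \<le> \<beta>" "\<beta> \<le> 1"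
      and step: "\<forall>i\<in>{1..N}. \<sigma> \<le> step_size (ch i)"
      and bnd: "norm x' \<le> B" "norm x \<le> B" "norm p \<le> B" "norm w \<le> B" for \<beta> x' x ch p w
  proof (cases "J w = \<infinity>")
    case False
    obtain f where f: "\<And>i. i \<in> {1..N} \<Longrightarrow> F i (block blk i w) = ereal (f i)"
      and Jw: "J w = ereal (H w + (\<Sum>i=1..N. f i))"
      using objective_finite[OF False] by blast
    define a e where "a = norm (p - x) + norm (x - x')" and "e = norm (w - p)"
    define k where "k i = (M i)\<^sup>2 / \<sigma> + 2 * L" for i
    have est: "F i (block blk i p)
      \<le> ereal (f i + (block blk i (grad H p) \<bullet> (w - p) + k i * a * e + k i * e\<^sup>2))" if i: "i \<in> {1..N}" for i
      using pass_block_estimate[OF pass i \<beta> \<sigma> _ bnd _ _ L, of "M i"] step i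
        M(1)[OF i] M(2)[OF i ggbpl_passD(1)[OF pass i]] f[OF i]
      by (simp add: k_def a_def e_def less_imp_le)
    have "(\<Sum>i=1..N. F i (block blk i p))
      \<le> (\<Sum>i=1..N. ereal (f i + (block blk i (grad H p) \<bullet> (w - p) + k i * a * e + k i * e\<^sup>2)))"
      by (intro sum_mono est)
    also have "\<dots> = ereal ((\<Sum>i=1..N. f i) + (grad H p \<bullet> (w - p) + (\<Sum>i=1..N. k i) * a * e + (\<Sum>i=1..N. k i) * e\<^sup>2))"
    proof -
      have "(\<Sum>i=1..N. block blk i (grad H p) \<bullet> (w - p)) = grad H p \<bullet> (w - p)"
        by (simp only: sum_block[OF blocks] flip: inner_sum_left)
      then show ?thesis
        by (simp add: sum.distrib sum_distrib_right)
    qed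
    finally have terms_le: "(\<Sum>i=1..N. F i (block blk i p))
      \<le> ereal ((\<Sum>i=1..N. f i) + (grad H p \<bullet> (w - p) + (\<Sum>i=1..N. k i) * a * e + (\<Sum>i=1..N. k i) * e\<^sup>2))" .
    have H_le: "H p + grad H p \<bullet> (w - p) \<le> H w + L * e\<^sup>2"
      unfolding e_def
      by (rule lipschitz_grad_lower_bound[OF differentiable convex_cball L]) (use bnd B in auto)
    have "0 \<le> L * a * e" using L0 by (simp add: a_def e_def)
    moreover have "K * a * e + K * e\<^sup>2 = (\<Sum>i=1..N. k i) * a * e + (\<Sum>i=1..N. k i) * e\<^sup>2 + L * a * e + L * e\<^sup>2"
      by (simp add: K_def k_def algebra_simps)
    ultimately have real_le: "H p + ((\<Sum>i=1..N. f i) + (grad H p \<bullet> (w - p) + (\<Sum>i=1..N. k i) * a * e + (\<Sum>i=1..N. k i) * e\<^sup>2))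
      \<le> H w + (\<Sum>i=1..N. f i) + (K * a * e + K * e\<^sup>2)"
      using H_le by linarith
    have "J p \<le> ereal (H p) + ereal ((\<Sum>i=1..N. f i) + (grad H p \<bullet> (w - p) + (\<Sum>i=1..N. k i) * a * e + (\<Sum>i=1..N. k i) * e\<^sup>2))"
      unfolding objective_def by (intro add_left_mono terms_le)
    also have "\<dots> \<le> J w + ereal (K * a * e + K * e\<^sup>2)"
      unfolding Jw using real_le by simp
    finally show ?thesis by (simp add: a_def e_def)
  qed simp
  with K0 show ?thesis by blast
qed

end

section \<open>Extrapolation weights and distance to the cluster points\<close>

lemma t_seq_nonneg: "0 \<le> t_seq k"
  by (cases k) simp_all

lemma t_seq_mono: "t_seq k \<le> t_seq (Suc k)"
proof -
  have "2 * t_seq k = sqrt (4 * (t_seq k)\<^sup>2)"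
    using t_seq_nonneg[of k] by (simp add: real_sqrt_mult)
  also have "\<dots> \<le> sqrt (1 + 4 * (t_seq k)\<^sup>2)" by simp
  finally show ?thesis by simp
qed

lemma extrapolation_bounds:
  assumes "1 \<le> k"
  shows "0 \<le> extrapolation k" "extrapolation k \<le> 1"
proof -
  obtain m where k: "k = Suc m" using assms by (cases k) auto
  have "0 < t_seq (Suc m)" by (simp add: add_pos_nonneg)
  then show "0 \<le> extrapolation k" "extrapolation k \<le> 1"
    using t_seq_nonneg[of m] t_seq_mono[of m] unfolding k extrapolation_def
    by (simp_all del: t_seq.simps)
qed

text \<open>Otherwise infinitely many terms keep distance \<open>\<epsilon>\<close>; by compactness
  some of them converge, and their limit is a cluster point.\<close>

lemma eventually_near_cluster_points:
  fixes z :: "nat \<Rightarrow> 'a::metric_space"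
  assumes K: "compact K" "\<And>n. z n \<in> K" and \<epsilon>: "0 < \<epsilon>"
  shows "eventually (\<lambda>n. ereal_dist (z n) (cluster_points z) < ereal \<epsilon>) sequentially"
proof (rule ccontr)
  define Q where "Q n \<longleftrightarrow> \<not> ereal_dist (z n) (cluster_points z) < ereal \<epsilon>" for n
  assume "\<not> ?thesis"
  then have "infinite {n. Q n}"
    by (simp add: Q_def eventually_cofinite cofinite_eq_sequentially[symmetric])
  then obtain s :: "nat \<Rightarrow> nat" where s: "strict_mono s" "\<And>n. Q (s n)"
    using infinite_enumerate by blast
  obtain l t where t: "strict_mono (t :: nat \<Rightarrow> nat)" "((z \<circ> s) \<circ> t) \<longlonglongrightarrow> l"
    using K unfolding compact_def by (metis comp_apply)
  have l: "l \<in> cluster_points z"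
    using strict_mono_o[OF s(1) t(1)] t(2) by (auto simp: cluster_points_def o_def)
  obtain n where n: "dist (z (s (t n))) l < \<epsilon>"
    using tendstoD[OF t(2) \<epsilon>] by (auto simp: eventually_sequentially)
  have "ereal_dist (z (s (t n))) (cluster_points z) \<le> ereal (dist (z (s (t n))) l)"
    unfolding ereal_dist_def using l by (rule INF_lower)
  also have "\<dots> < ereal \<epsilon>" using n by simp
  finally show False using s(2)[of "t n"] by (simp add: Q_def)
qed

section \<open>Descent and boundedness of the iterates\<close>

locale iGGBPL_run = block_problem +
  fixes \<rho> :: real and ch :: "nat \<Rightarrow> nat \<Rightarrow> (real^'a) block_choice" and z :: "nat \<Rightarrow> real^'a"
  assumes objective: "admissible_objective (objective blk N H F)"
    and algorithm: "iGGBPL blk N H F D \<rho> ch z"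
    and inf_gs: "0 < (INF (i, k) \<in> {1..N} \<times> {1..}. (gparam (ch k i) - 1) * sparam (ch k i))"
    and inf_sigma: "0 < (INF (i, k) \<in> {1..N} \<times> {1..}. step_size (ch k i))"
begin

lemma rho_pos: "0 < \<rho>"
  using algorithm by (simp add: iGGBPL_def)

text \<open>The rejected trial is forgotten: after a rejection, descent comes from the pass with
  weight 0 itself instead of from the acceptance test.\<close>

lemma run_step:
  assumes "1 \<le> k"
  shows "(ggbpl_pass blk N H F D (extrapolation k) (z (k - 1)) (z k) (ch k) (z (k + 1)) \<and>
      sufficient_decrease blk N H F \<rho> (z k) (ch k) (z (k + 1))) \<or>
    ggbpl_pass blk N H F D 0 (z (k - 1)) (z k) (ch k) (z (k + 1))"
  using algorithm assms unfolding iGGBPL_def by blast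

lemma run_pass:
  assumes "1 \<le> k"
  obtains \<beta> where "0 \<le> \<beta>" "\<beta> \<le> 1" "ggbpl_pass blk N H F D \<beta> (z (k - 1)) (z k) (ch k) (z (k + 1))"
  using run_step[OF assms] extrapolation_bounds[OF assms] that[of 0] that[of "extrapolation k"] by auto

lemma parameters_pos:
  assumes "1 \<le> k" "i \<in> {1..N}"
  shows "0 < sparam (ch k i)" "1 < gparam (ch k i)"
proof -
  obtain \<beta> where "ggbpl_pass blk N H F D \<beta> (z (k - 1)) (z k) (ch k) (z (k + 1))"
    using run_pass[OF assms(1)] by blast
  from ggbpl_passD[OF this assms(2)]
  show "0 < sparam (ch k i)" "1 < gparam (ch k i)" by linarith+
qed

lemma parameters_uniform:
  obtains \<tau> \<sigma> where "0 < \<tau>" "0 < \<sigma>"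
    "\<And>k i. 1 \<le> k \<Longrightarrow> i \<in> {1..N} \<Longrightarrow> \<tau> \<le> (gparam (ch k i) - 1) * sparam (ch k i)"
    "\<And>k i. 1 \<le> k \<Longrightarrow> i \<in> {1..N} \<Longrightarrow> \<sigma> \<le> step_size (ch k i)"
proof (rule that[OF inf_gs inf_sigma])
  fix k i assume k: "1 \<le> (k :: nat)" and i: "i \<in> {1..N}"
  \<comment> \<open>A real infimum is a lower bound only when the set is bounded below; positivity
    of the parameters supplies the bound 0.\<close>
  have "bdd_below ((\<lambda>(i, k). (gparam (ch k i) - 1) * sparam (ch k i)) ` ({1..N} \<times> {1..}))"
    using parameters_pos by (intro bdd_belowI2[of _ 0]) (auto simp: less_imp_le)
  from cINF_lower[OF this, of "(i, k)"] k i
  show "(INF (i, k) \<in> {1..N} \<times> {1..}. (gparam (ch k i) - 1) * sparam (ch k i))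
      \<le> (gparam (ch k i) - 1) * sparam (ch k i)" by simp
  have pos: "0 \<le> step_size (ch k i)" if "1 \<le> k" "i \<in> {1..N}" for k i
    using parameters_pos[OF that] by (simp add: step_size_def)
  have "bdd_below ((\<lambda>(i, k). step_size (ch k i)) ` ({1..N} \<times> {1..}))"
    using pos by (intro bdd_belowI2[of _ 0]) auto
  from cINF_lower[OF this, of "(i, k)"] k i
  show "(INF (i, k) \<in> {1..N} \<times> {1..}. step_size (ch k i)) \<le> step_size (ch k i)" by simp
qed

lemma metrics_lower_bound:
  obtains m where "0 < m"
    "\<And>i d u v. i \<in> {1..N} \<Longrightarrow> d \<in> D i \<Longrightarrow> u \<in> block_space blk i \<Longrightarrow> v \<in> block_space blk i \<Longrightarrow>
      m * norm (u - v) \<le> d u v"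
proof -
  have "\<forall>i\<in>{1..N}. \<exists>c>0. \<forall>d\<in>D i. \<forall>u\<in>block_space blk i. \<forall>v\<in>block_space blk i. c * norm (u - v) \<le> d u v"
    using admissible_metrics_lower_bound[OF subspace_block_space metrics] by blast
  then obtain c where c: "\<And>i. i \<in> {1..N} \<Longrightarrow> 0 < c i"
    "\<And>i d u v. i \<in> {1..N} \<Longrightarrow> d \<in> D i \<Longrightarrow> u \<in> block_space blk i \<Longrightarrow> v \<in> block_space blk i \<Longrightarrow>
      c i * norm (u - v) \<le> d u v"
    by metis
  \<comment> \<open>The inserted 1 keeps the set nonempty whatever \<open>N\<close> is.\<close>
  define m where "m = Min (insert 1 (c ` {1..N}))"
  have "0 < m" using c(1) by (simp add: m_def)
  moreover have "m * norm (u - v) \<le> d u v"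
    if "i \<in> {1..N}" "d \<in> D i" "u \<in> block_space blk i" "v \<in> block_space blk i" for i d u v
  proof -
    have "m \<le> c i" unfolding m_def by (rule Min_le) (use that(1) in auto)
    then have "m * norm (u - v) \<le> c i * norm (u - v)" by (intro mult_right_mono) auto
    also have "\<dots> \<le> d u v" using c(2) that by blast
    finally show ?thesis .
  qed
  ultimately show ?thesis by (rule that)
qed

lemma objective_decrease:
  obtains c where "0 < c"
    "\<And>k. 1 \<le> k \<Longrightarrow> J (z (k + 1)) + ereal (c * (norm (z (k + 1) - z k))\<^sup>2) \<le> J (z k)"
proof -
  obtain \<tau> where \<tau>: "0 < \<tau>"
    "\<And>k i. 1 \<le> k \<Longrightarrow> i \<in> {1..N} \<Longrightarrow> \<tau> \<le> (gparam (ch k i) - 1) * sparam (ch k i)"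
    by (rule parameters_uniform) blast
  obtain m where m: "0 < m"
    "\<And>i d u v. i \<in> {1..N} \<Longrightarrow> d \<in> D i \<Longrightarrow> u \<in> block_space blk i \<Longrightarrow> v \<in> block_space blk i \<Longrightarrow>
      m * norm (u - v) \<le> d u v"
    by (rule metrics_lower_bound) blast
  \<comment> \<open>\<open>\<rho>\<close> serves the steps accepted by the test,
    \<open>\<tau> / 2\<close> those of a second pass, and the square of \<open>m\<close> converts
    metrics into norms.\<close>
  define c where "c = min \<rho> (\<tau> / 2) * m\<^sup>2"
  have c: "0 < c" using rho_pos \<tau>(1) m(1) by (simp add: c_def)
  have "J (z (k + 1)) + ereal (c * (norm (z (k + 1) - z k))\<^sup>2) \<le> J (z k)" if k: "1 \<le> k" for k
  proof (cases "J (z k) = \<infinity>")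
    case False
    define d where "d i = (metric (ch k i) (block blk i (z (k + 1))) (block blk i (z k)))\<^sup>2" for i
    obtain \<beta> where pass: "ggbpl_pass blk N H F D \<beta> (z (k - 1)) (z k) (ch k) (z (k + 1))"
      using run_pass[OF k] by blast
    have "m\<^sup>2 * (norm (block blk i (z (k + 1) - z k)))\<^sup>2 \<le> d i" if i: "i \<in> {1..N}" for i
    proof -
      have "m * norm (block blk i (z (k + 1) - z k))
          \<le> metric (ch k i) (block blk i (z (k + 1))) (block blk i (z k))"
        using m(2)[OF i ggbpl_passD(1)[OF pass i]] by (simp add: block_diff)
      then have "(m * norm (block blk i (z (k + 1) - z k)))\<^sup>2 \<le> d i"
        unfolding d_def using m(1) by (intro power_mono) auto
      then show ?thesis by (simp add: power_mult_distrib)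
    qed
    then have "m\<^sup>2 * (norm (z (k + 1) - z k))\<^sup>2 \<le> (\<Sum>i=1..N. d i)"
      unfolding sum_norm_block_squared[OF blocks, of "z (k + 1) - z k", symmetric] sum_distrib_left by (intro sum_mono)
    then have "min \<rho> (\<tau> / 2) * (m\<^sup>2 * (norm (z (k + 1) - z k))\<^sup>2) \<le> min \<rho> (\<tau> / 2) * (\<Sum>i=1..N. d i)"
      using rho_pos \<tau>(1) by (intro mult_left_mono) auto
    then have le: "c * (norm (z (k + 1) - z k))\<^sup>2 \<le> min \<rho> (\<tau> / 2) * (\<Sum>i=1..N. d i)"
      by (simp add: c_def mult.assoc)
    have d0: "0 \<le> d i" for i by (simp add: d_def)
    then have sum0: "0 \<le> (\<Sum>i=1..N. d i)" by (simp add: sum_nonneg)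
    from run_step[OF k] show ?thesis
    proof
      assume "ggbpl_pass blk N H F D (extrapolation k) (z (k - 1)) (z k) (ch k) (z (k + 1)) \<and>
        sufficient_decrease blk N H F \<rho> (z k) (ch k) (z (k + 1))"
      then have "J (z (k + 1)) \<le> J (z k) - ereal (\<rho> * (\<Sum>i=1..N. d i))"
        by (simp add: sufficient_decrease_def d_def)
      moreover have "min \<rho> (\<tau> / 2) * (\<Sum>i=1..N. d i) \<le> \<rho> * (\<Sum>i=1..N. d i)"
        using sum0 by (intro mult_right_mono) auto
      ultimately show ?thesis
        using le False objective_not_MInf[of "z k"]
        by (cases "J (z k)"; cases "J (z (k + 1))") auto
    next
      assume pass0: "ggbpl_pass blk N H F D 0 (z (k - 1)) (z k) (ch k) (z (k + 1))"
      have "min \<rho> (\<tau> / 2) * (\<Sum>i=1..N. d i) \<le> (\<Sum>i=1..N. (gparam (ch k i) - 1) * sparam (ch k i) / 2 * d i)"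
        unfolding sum_distrib_left
      proof (rule sum_mono)
        fix i assume "i \<in> {1..N}"
        then have "min \<rho> (\<tau> / 2) \<le> (gparam (ch k i) - 1) * sparam (ch k i) / 2"
          using \<tau>(2)[OF k] by fastforce
        then show "min \<rho> (\<tau> / 2) * d i \<le> (gparam (ch k i) - 1) * sparam (ch k i) / 2 * d i"
          using d0 by (intro mult_right_mono)
      qed
      with le have "ereal (c * (norm (z (k + 1) - z k))\<^sup>2)
          \<le> ereal (\<Sum>i=1..N. (gparam (ch k i) - 1) * sparam (ch k i) / 2 * d i)"
        by simp
      then have "J (z (k + 1)) + ereal (c * (norm (z (k + 1) - z k))\<^sup>2)
          \<le> J (z (k + 1)) + ereal (\<Sum>i=1..N. (gparam (ch k i) - 1) * sparam (ch k i) / 2 * d i)"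
        by (rule add_left_mono)
      also have "\<dots> \<le> J (z k)"
        using pass_objective_decrease[OF pass0 False] by (simp add: d_def)
      finally show ?thesis .
    qed
  qed simp
  with c show ?thesis by (rule that)
qed

lemma objective_le_start: "J (z k) \<le> J (z 0)"
proof (induction k)
  case (Suc k)
  obtain c where c: "0 < c"
    "\<And>k. 1 \<le> k \<Longrightarrow> J (z (k + 1)) + ereal (c * (norm (z (k + 1) - z k))\<^sup>2) \<le> J (z k)"
    by (rule objective_decrease) blast
  \<comment> \<open>The algorithm starts at index 1; index 0 is tied to it by
    \<open>z 1 = z 0\<close>.\<close>
  show ?case
  proof (cases "k = 0")
    case True
    then show ?thesis using algorithm by (simp add: iGGBPL_def)
  next
    case False
    have "J (z (k + 1)) + 0 \<le> J (z (k + 1)) + ereal (c * (norm (z (k + 1) - z k))\<^sup>2)"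
      using c(1) by (intro add_left_mono) auto
    also have "\<dots> \<le> J (z k)" using c(2) False by simp
    finally show ?thesis using Suc by simp
  qed
qed simp

lemma objective_run_finite:
  obtains j where "\<And>k. J (z k) = ereal (j k)"
proof -
  have "J (z k) \<noteq> \<infinity>" for k
    using objective_le_start[of k] algorithm by (auto simp: iGGBPL_def)
  then have "J (z k) = ereal (real_of_ereal (J (z k)))" for k
    using objective_not_MInf[of "z k"] by (auto simp: ereal_real)
  then show ?thesis by (rule that)
qed

lemma run_bounded:
  obtains B where "0 \<le> B" "\<And>k. norm (z k) \<le> B"
proof -
  obtain j where j: "\<And>k. J (z k) = ereal (j k)" using objective_run_finite by blast
  have "(J \<longlongrightarrow> \<infinity>) at_infinity" using objective by (simp add: admissible_objective_def)
  then have "eventually (\<lambda>x. ereal (j 0) < J x) at_infinity"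
    by (rule order_tendstoD(1)) simp
  then obtain b where b: "\<And>x. b \<le> norm x \<Longrightarrow> ereal (j 0) < J x"
    by (auto simp: eventually_at_infinity)
  have "norm (z k) \<le> \<bar>b\<bar>" for k
    using b[of "z k"] objective_le_start[of k] j by (cases "b \<le> norm (z k)") auto
  then show ?thesis using that[of "\<bar>b\<bar>"] by simp
qed


lemma real_objective_sequence:
  obtains j js c where "\<And>k. J (z k) = ereal (j k)" "j \<longlonglongrightarrow> js" "\<And>k. js \<le> j k" "0 < c"
    "\<And>k. 1 \<le> k \<Longrightarrow> j (k + 1) + c * (norm (z (k + 1) - z k))\<^sup>2 \<le> j k"
proof -
  obtain j where j: "\<And>k. J (z k) = ereal (j k)" using objective_run_finite by blast
  obtain c where c: "0 < c"
    "\<And>k. 1 \<le> k \<Longrightarrow> J (z (k + 1)) + ereal (c * (norm (z (k + 1) - z k))\<^sup>2) \<le> J (z k)"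
    by (rule objective_decrease) blast
  have dec: "j (k + 1) + c * (norm (z (k + 1) - z k))\<^sup>2 \<le> j k" if "1 \<le> k" for k
    using c(2)[OF that] by (simp add: j)
  have "decseq j"
  proof (rule decseq_SucI)
    fix k
    show "j (Suc k) \<le> j k"
    proof (cases "k = 0")
      case True
      have "z 1 = z 0" using algorithm by (simp add: iGGBPL_def)
      then have "ereal (j 1) = ereal (j 0)" by (simp flip: j)
      then show ?thesis using True by simp
    next
      case False
      have "0 \<le> c * (norm (z (k + 1) - z k))\<^sup>2" using c(1) by simp
      moreover have "j (k + 1) + c * (norm (z (k + 1) - z k))\<^sup>2 \<le> j k"
        using dec[of k] False by simp
      ultimately have "j (k + 1) \<le> j k" by linarith
      then show ?thesis by simp
    qed
  qed
  moreover obtain b where "\<And>x. ereal b \<le> J x"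
    using objective by (auto simp: admissible_objective_def bounded_below_on_def)
  then have "b \<le> j k" for k by (metis ereal_less_eq(3) j)
  ultimately obtain js where js: "j \<longlonglongrightarrow> js" "\<And>k. js \<le> j k"
    using decseq_convergent[of j b] by blast
  show ?thesis by (rule that[OF j js c(1) dec])
qed

section \<open>Subgradients at the iterates and values at the cluster points\<close>

text \<open>The radius for \<open>w\<close> is \<open>B + 1\<close> so that \<open>w\<close> may
  range over the unit ball around any iterate, as the slope bound requires.\<close>

lemma objective_estimate:
  obtains K B where "0 \<le> K" "0 \<le> B" "\<And>k. norm (z k) \<le> B"
    "\<And>k w. 1 \<le> k \<Longrightarrow> norm w \<le> B + 1 \<Longrightarrow> J (z (k + 1)) \<le> J w +
      ereal (K * (norm (z (k + 1) - z k) + norm (z k - z (k - 1))) * norm (w - z (k + 1))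
        + K * (norm (w - z (k + 1)))\<^sup>2)"
proof -
  obtain B where B: "0 \<le> B" "\<And>k. norm (z k) \<le> B" using run_bounded by blast
  obtain \<sigma> where \<sigma>: "0 < \<sigma>" "\<And>k i. 1 \<le> k \<Longrightarrow> i \<in> {1..N} \<Longrightarrow> \<sigma> \<le> step_size (ch k i)"
    by (rule parameters_uniform) blast
  obtain K where K: "0 \<le> K"
    "\<And>\<beta> x' x ch p w. ggbpl_pass blk N H F D \<beta> x' x ch p \<Longrightarrow> 0 \<le> \<beta> \<Longrightarrow> \<beta> \<le> 1 \<Longrightarrow>
      (\<forall>i\<in>{1..N}. \<sigma> \<le> step_size (ch i)) \<Longrightarrow>
      norm x' \<le> B + 1 \<Longrightarrow> norm x \<le> B + 1 \<Longrightarrow> norm p \<le> B + 1 \<Longrightarrow> norm w \<le> B + 1 \<Longrightarrow>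
      J p \<le> J w + ereal (K * (norm (p - x) + norm (x - x')) * norm (w - p) + K * (norm (w - p))\<^sup>2)"
    using pass_objective_estimate[of "B + 1" \<sigma>] B(1) \<sigma>(1) by auto
  have zB: "norm (z k) \<le> B + 1" for k using B(2)[of k] by simp
  show ?thesis
  proof (rule that[OF K(1) B])
    fix k w assume k: "1 \<le> (k::nat)" and w: "norm (w :: real^'a) \<le> B + 1"
    obtain \<beta> where "0 \<le> \<beta>" "\<beta> \<le> 1" "ggbpl_pass blk N H F D \<beta> (z (k - 1)) (z k) (ch k) (z (k + 1))"
      by (rule run_pass[OF k])
    then show "J (z (k + 1)) \<le> J w +
      ereal (K * (norm (z (k + 1) - z k) + norm (z k - z (k - 1))) * norm (w - z (k + 1))
        + K * (norm (w - z (k + 1)))\<^sup>2)"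
      using \<sigma>(2)[OF k] zB w by (intro K(2)) auto
  qed
qed

lemma subdiff_bound:
  obtains K where "0 \<le> K"
    "\<And>k. 1 \<le> k \<Longrightarrow> ereal_dist 0 (limiting_subdiff J (z (k + 1)))
      \<le> ereal (K * (norm (z (k + 1) - z k) + norm (z k - z (k - 1))))"
proof -
  obtain j where j: "\<And>k. J (z k) = ereal (j k)" using objective_run_finite by blast
  obtain K B where K: "0 \<le> K" "0 \<le> B" "\<And>k. norm (z k) \<le> B"
    "\<And>k w. 1 \<le> k \<Longrightarrow> norm w \<le> B + 1 \<Longrightarrow> J (z (k + 1)) \<le> J w +
      ereal (K * (norm (z (k + 1) - z k) + norm (z k - z (k - 1))) * norm (w - z (k + 1))
        + K * (norm (w - z (k + 1)))\<^sup>2)"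
    by (rule objective_estimate) blast
  show ?thesis
  proof (rule that[OF K(1)])
    fix k assume k: "1 \<le> (k::nat)"
    show "ereal_dist 0 (limiting_subdiff J (z (k + 1)))
      \<le> ereal (K * (norm (z (k + 1) - z k) + norm (z k - z (k - 1))))"
    proof (rule ereal_dist_limiting_subdiff_le_slope[OF lsc_objective objective_not_MInf j _ zero_less_one])
      show "0 \<le> K * (norm (z (k + 1) - z k) + norm (z k - z (k - 1)))" using K(1) by simp
      fix u assume "dist (z (k + 1)) u \<le> 1"
      then have "norm u \<le> B + 1"
        using norm_triangle_sub[of u "z (k + 1)"] K(3)[of "k + 1"]
        by (simp add: dist_norm norm_minus_commute)
      then show "J (z (k + 1)) \<le> J u +
          ereal (K * (norm (z (k + 1) - z k) + norm (z k - z (k - 1))) * norm (u - z (k + 1))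
            + K * (norm (u - z (k + 1)))\<^sup>2)"
        by (rule K(4)[OF k])
    qed
  qed
qed

text \<open>Lower semicontinuity yields only \<open>J x \<le> js\<close>, and with it finiteness of
  \<open>J x\<close>. The reverse inequality comes from taking the cluster point itself as the
  comparison point.\<close>

lemma objective_cluster_point:
  assumes x: "x \<in> cluster_points z" and js: "(\<lambda>k. J (z k)) \<longlonglongrightarrow> ereal js"
  shows "J x = ereal js"
proof -
  obtain j where j: "\<And>k. J (z k) = ereal (j k)" using objective_run_finite by blast
  obtain s where s: "strict_mono (s :: nat \<Rightarrow> nat)" "(\<lambda>k. z (s k)) \<longlonglongrightarrow> x"
    using x by (auto simp: cluster_points_def)
  have Js: "(\<lambda>k. J (z (s k))) \<longlonglongrightarrow> ereal js"
    using LIMSEQ_subseq_LIMSEQ[OF js s(1)] by (simp add: o_def)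
  have upper: "J x \<le> ereal js"
    using lsc_on_UNIV_LIMSEQ_le[OF lsc_objective s(2) Js] .
  then obtain jx where jx: "J x = ereal jx"
    using objective_not_MInf[of x] by (cases "J x") auto
  obtain K B where K: "0 \<le> K" "0 \<le> B" "\<And>k. norm (z k) \<le> B"
    "\<And>k w. 1 \<le> k \<Longrightarrow> norm w \<le> B + 1 \<Longrightarrow> J (z (k + 1)) \<le> J w +
      ereal (K * (norm (z (k + 1) - z k) + norm (z k - z (k - 1))) * norm (w - z (k + 1))
        + K * (norm (w - z (k + 1)))\<^sup>2)"
    by (rule objective_estimate) blast
  have "norm x \<le> B"
    using tendsto_norm[OF s(2)] K(3) by (intro LIMSEQ_le_const2[of "\<lambda>k. norm (z (s k))"]) auto
  then have xB: "norm x \<le> B + 1" by simp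
  \<comment> \<open>The crude bound \<open>4 * B\<close> on two steps is enough: the factor
    \<open>norm (x - z n)\<close> already tends to 0 along the subsequence. The estimate holds at
    \<open>n = k + 1\<close> with \<open>k \<ge> 1\<close>, hence \<open>2 \<le> n\<close>.\<close>
  have bound: "j n \<le> jx + (K * (4 * B) * norm (x - z n) + K * (norm (x - z n))\<^sup>2)" if n: "2 \<le> n" for n
  proof -
    define k where "k = n - 1"
    have k: "1 \<le> k" "n = k + 1" using n by (auto simp: k_def)
    have "norm (z (k + 1) - z k) + norm (z k - z (k - 1)) \<le> 4 * B"
      using norm_triangle_ineq4[of "z (k + 1)" "z k"] norm_triangle_ineq4[of "z k" "z (k - 1)"]
        K(3)[of "k + 1"] K(3)[of k] K(3)[of "k - 1"] by linarith
    then have "K * (norm (z (k + 1) - z k) + norm (z k - z (k - 1))) * norm (x - z n)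
        \<le> K * (4 * B) * norm (x - z n)"
      using K(1) by (intro mult_right_mono mult_left_mono) auto
    with K(4)[OF k(1) xB] show ?thesis
      unfolding k(2)[symmetric] j jx by simp
  qed
  have "js \<le> jx"
  proof (rule LIMSEQ_le)
    show "(\<lambda>k. j (s k)) \<longlonglongrightarrow> js" using Js by (simp add: j)
    have diff: "(\<lambda>k. norm (x - z (s k))) \<longlonglongrightarrow> 0"
      using tendsto_norm[OF tendsto_diff[OF tendsto_const[of x] s(2)]] by simp
    have "(\<lambda>k. jx + (K * (4 * B) * norm (x - z (s k)) + K * (norm (x - z (s k)))\<^sup>2))
        \<longlonglongrightarrow> jx + (K * (4 * B) * 0 + K * 0\<^sup>2)"
      by (intro tendsto_intros diff)
    then show "(\<lambda>k. jx + (K * (4 * B) * norm (x - z (s k)) + K * (norm (x - z (s k)))\<^sup>2)) \<longlonglongrightarrow> jx"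
      by simp
    have "2 \<le> s k" if "2 \<le> k" for k
      using seq_suble[OF s(1), of k] that by simp
    then show "\<exists>n. \<forall>k\<ge>n. j (s k) \<le> jx + (K * (4 * B) * norm (x - z (s k)) + K * (norm (x - z (s k)))\<^sup>2)"
      using bound by blast
  qed
  with upper jx show ?thesis by simp
qed

section \<open>The Kurdyka--Lojasiewicz inequality along the iterates\<close>

text \<open>The desingularizing function has derivative \<open>C * t powr (\<theta> - 1)\<close> at
  the gap \<open>t\<close>; after the subgradient bound is inserted, multiplying by
  \<open>t powr (1 - \<theta>)\<close> isolates the gap. Positivity of the gap is the condition
  \<open>J xbar < J x\<close> of the inequality.\<close>

lemma gap_powr_bound:
  assumes \<theta>: "0 < \<theta>" and C: "0 < C"
    and KL: "uniformized_KL J (cluster_points z) (\<lambda>t. C / \<theta> * t powr \<theta>)"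
    and j: "\<And>k. J (z k) = ereal (j k)" and js: "j \<longlonglongrightarrow> js"
  obtains K k0 where "0 < K" "\<And>k. k0 \<le> k \<Longrightarrow> js < j (k + 2) \<Longrightarrow>
    (j (k + 2) - js) powr (1 - \<theta>) \<le> K * (norm (z (k + 2) - z (k + 1)) + norm (z (k + 1) - z k))"
proof -
  obtain \<epsilon> \<eta> where \<epsilon>: "0 < (\<epsilon>::real)" and \<eta>: "0 < (\<eta>::ereal)"
    and KL_ineq: "\<And>xbar x. xbar \<in> cluster_points z \<Longrightarrow> ereal_dist x (cluster_points z) < ereal \<epsilon> \<Longrightarrow>
      J xbar < J x \<Longrightarrow> J x < J xbar + \<eta> \<Longrightarrow> KL_inequality J (\<lambda>t. C / \<theta> * t powr \<theta>) xbar x"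
    using KL unfolding uniformized_KL_def by blast
  obtain K where K: "0 \<le> K"
    "\<And>k. 1 \<le> k \<Longrightarrow> ereal_dist 0 (limiting_subdiff J (z (k + 1)))
      \<le> ereal (K * (norm (z (k + 1) - z k) + norm (z k - z (k - 1))))"
    by (rule subdiff_bound) blast
  obtain B where B: "\<And>k. norm (z k) \<le> B" using run_bounded by blast
  have zB: "z k \<in> cball 0 B" for k using B by simp
  \<comment> \<open>The inequality is relative to a cluster point, so one has to exist. Any one will
    do, since \<open>J\<close> equals \<open>js\<close> on all of them.\<close>
  obtain xbar s where "strict_mono (s :: nat \<Rightarrow> nat)" "(z \<circ> s) \<longlonglongrightarrow> xbar"
    using compact_cball[of "0 :: real^'a" B] zB unfolding compact_def by blast
  then have xbar: "xbar \<in> cluster_points z"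
    by (auto simp: cluster_points_def o_def)
  have Jx: "J xbar = ereal js"
    using js by (intro objective_cluster_point[OF xbar]) (simp add: j)
  have "eventually (\<lambda>k. ereal (j k) < ereal js + \<eta>) sequentially"
  proof (rule order_tendstoD(2))
    show "(\<lambda>k. ereal (j k)) \<longlonglongrightarrow> ereal js" using js by simp
    show "ereal js < ereal js + \<eta>" using \<eta> by (cases \<eta>) auto
  qed
  from eventually_conj[OF this eventually_near_cluster_points[of "cball 0 B" z, OF compact_cball zB \<epsilon>]]
  obtain k0 where k0: "\<And>k. k0 \<le> k \<Longrightarrow> ereal (j k) < ereal js + \<eta>"
    "\<And>k. k0 \<le> k \<Longrightarrow> ereal_dist (z k) (cluster_points z) < ereal \<epsilon>"
    by (auto simp: eventually_sequentially)
  \<comment> \<open>Adding 1 keeps the constant positive even when \<open>K = 0\<close>.\<close>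
  have "(j (k + 2) - js) powr (1 - \<theta>)
      \<le> (C * K + 1) * (norm (z (k + 2) - z (k + 1)) + norm (z (k + 1) - z k))"
    if k: "k0 \<le> k" and pos: "js < j (k + 2)" for k
  proof -
    define t where "t = j (k + 2) - js"
    define a where "a = norm (z (k + 2) - z (k + 1)) + norm (z (k + 1) - z k)"
    have t: "0 < t" using pos by (simp add: t_def)
    have a: "0 \<le> a" by (simp add: a_def)
    have "KL_inequality J (\<lambda>t. C / \<theta> * t powr \<theta>) xbar (z (k + 2))"
      using k0[of "k + 2"] k pos by (intro KL_ineq[OF xbar]) (auto simp: Jx j)
    moreover have "((\<lambda>t. C / \<theta> * t powr \<theta>) has_real_derivative C * t powr (\<theta> - 1)) (at t)"
      using t \<theta> by (auto intro!: derivative_eq_intros)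
    then have "deriv (\<lambda>t. C / \<theta> * t powr \<theta>) t = C * t powr (\<theta> - 1)"
      by (rule DERIV_imp_deriv)
    moreover have "real_of_ereal (J (z (k + 2)) - J xbar) = t"
      by (simp only: j Jx t_def ereal_minus real_of_ereal.simps)
    ultimately have "1 \<le> ereal (C * t powr (\<theta> - 1)) * ereal_dist 0 (limiting_subdiff J (z (k + 2)))"
      by (simp only: KL_inequality_def)
    also have "\<dots> \<le> ereal (C * t powr (\<theta> - 1)) * ereal (K * a)"
      using K(2)[of "k + 1"] C by (intro ereal_mult_left_mono) (auto simp: a_def numeral_2_eq_2)
    finally have one: "1 \<le> C * t powr (\<theta> - 1) * (K * a)" by (simp add: one_ereal_def)
    have "t powr (1 - \<theta>) * 1 \<le> t powr (1 - \<theta>) * (C * t powr (\<theta> - 1) * (K * a))"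
      using one by (intro mult_left_mono) auto
    also have "\<dots> = (t powr (1 - \<theta>) * t powr (\<theta> - 1)) * (C * K * a)" by simp
    also have "t powr (1 - \<theta>) * t powr (\<theta> - 1) = 1"
      using t by (simp flip: powr_add)
    finally show ?thesis
      using a unfolding t_def[symmetric] a_def[symmetric] by (simp add: distrib_right)
  qed
  then show ?thesis using C K(1) by (intro that[of "C * K + 1" k0]) (auto simp: add_nonneg_pos)
qed

text \<open>Squaring replaces the sum of two step lengths by twice the sum of their squares; each
  square is paid for by one decrease, and the two decreases telescope to
  \<open>j k - j (k + 2)\<close>.\<close>

lemma gap_two_step:
  assumes \<theta>: "0 < \<theta>" and C: "0 < C"
    and KL: "uniformized_KL J (cluster_points z) (\<lambda>t. C / \<theta> * t powr \<theta>)"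
    and j: "\<And>k. J (z k) = ereal (j k)" and js: "j \<longlonglongrightarrow> js"
    and c: "0 < c" "\<And>k. 1 \<le> k \<Longrightarrow> j (k + 1) + c * (norm (z (k + 1) - z k))\<^sup>2 \<le> j k"
  obtains K k0 where "0 < K" "\<And>k. k0 \<le> k \<Longrightarrow> js < j (k + 2) \<Longrightarrow>
    (j (k + 2) - js) powr (2 - 2 * \<theta>) \<le> K * (j k - j (k + 2))"
proof -
  obtain K k0 where K: "0 < K" "\<And>k. k0 \<le> k \<Longrightarrow> js < j (k + 2) \<Longrightarrow>
    (j (k + 2) - js) powr (1 - \<theta>) \<le> K * (norm (z (k + 2) - z (k + 1)) + norm (z (k + 1) - z k))"
    by (rule gap_powr_bound[OF \<theta> C KL j js]) blast
  \<comment> \<open>The decrease is available from index 1 on, hence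
    \<open>max 1 k0\<close>.\<close>
  have "(j (k + 2) - js) powr (2 - 2 * \<theta>) \<le> 2 * K\<^sup>2 / c * (j k - j (k + 2))"
    if k: "max 1 k0 \<le> k" and pos: "js < j (k + 2)" for k
  proof -
    define a b where "a = norm (z (k + 2) - z (k + 1))" and "b = norm (z (k + 1) - z k)"
    have "(j (k + 2) - js) powr (2 - 2 * \<theta>) = ((j (k + 2) - js) powr (1 - \<theta>))\<^sup>2"
      using pos by (simp add: power2_eq_square flip: powr_add)
    also have "\<dots> \<le> (K * (a + b))\<^sup>2"
      using K(2)[of k] k pos unfolding a_def b_def by (intro power_mono) auto
    also have "\<dots> \<le> 2 * K\<^sup>2 * (a\<^sup>2 + b\<^sup>2)"
      using mult_left_mono[OF sum_squares_bound[of a b], of "K\<^sup>2"]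
      by (simp add: power2_eq_square algebra_simps)
    also have "\<dots> = 2 * K\<^sup>2 / c * (c * a\<^sup>2 + c * b\<^sup>2)"
      using c(1) by (simp add: field_simps)
    also have "\<dots> \<le> 2 * K\<^sup>2 / c * (j k - j (k + 2))"
      using c(2)[of k] c(2)[of "k + 1"] k c(1)
      by (intro mult_left_mono) (auto simp: a_def b_def numeral_2_eq_2)
    finally show ?thesis .
  qed
  then show ?thesis
    using K(1) c(1) by (intro that[of "2 * K\<^sup>2 / c" "max 1 k0"]) auto
qed

end

section \<open>The three convergence rates\<close>

theorem theorem5:
  fixes blk :: "'n::finite \<Rightarrow> nat" and N :: nat
    and H :: "real^'n \<Rightarrow> real" and F :: "nat \<Rightarrow> real^'n \<Rightarrow> ereal"
    and D :: "nat \<Rightarrow> (real^'n \<Rightarrow> real^'n \<Rightarrow> real) set"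
    and \<rho> :: real and ch :: "nat \<Rightarrow> nat \<Rightarrow> (real^'n) block_choice"
    and z :: "nat \<Rightarrow> real^'n" and C \<theta> :: real
  defines "J \<equiv> objective blk N H F"
  defines "r \<equiv> objective_gap J z"
  assumes blocks: "blk ` UNIV = {1..N}"
    and A1: "smooth_coupling blk N H"
    and A2: "admissible_terms blk N F"
    and A3: "admissible_objective J"
    and B: "\<And>i. i \<in> {1..N} \<Longrightarrow> admissible_metrics (block_space blk i) (D i)"
    and algorithm: "iGGBPL blk N H F D \<rho> ch z"
    and inf_gs: "0 < (INF (i, k) \<in> {1..N} \<times> {1..}. (gparam (ch k i) - 1) * sparam (ch k i))"
    and inf_sigma: "0 < (INF (i, k) \<in> {1..N} \<times> {1..}. step_size (ch k i))"
    and \<theta>: "0 < \<theta>" "\<theta> \<le> 1" and C: "0 < C"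
    and KL: "uniformized_KL J (cluster_points z) (\<lambda>t. C / \<theta> * t powr \<theta>)"
  shows "(\<theta> = 1 \<longrightarrow> (\<exists>k. r k = 0 \<and> (\<forall>m\<ge>k. z m = z k))) \<and>
    (1 / 2 \<le> \<theta> \<and> \<theta> < 1 \<longrightarrow>
       (\<exists>c\<^sub>1>0. \<exists>q. 0 < q \<and> q < 1 \<and> (\<exists>k\<^sub>2. \<forall>k\<ge>k\<^sub>2. r k \<le> ereal (c\<^sub>1 * q ^ (k - k\<^sub>2))))) \<and>
    (0 < \<theta> \<and> \<theta> < 1 / 2 \<longrightarrow>
       (\<exists>c\<^sub>2>0. \<exists>k\<^sub>3. \<forall>k>k\<^sub>3.
          r k \<le> ereal (c\<^sub>2 * real (k - k\<^sub>3) powr (- (1 / (1 - 2 * \<theta>))))))"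
proof -
  interpret iGGBPL_run blk N H F D \<rho> ch z
    using blocks A1 A2 A3[unfolded J_def] B algorithm inf_gs inf_sigma by unfold_locales
  obtain j js c where j: "\<And>k. objective blk N H F (z k) = ereal (j k)"
    and js: "j \<longlonglongrightarrow> js" "\<And>k. js \<le> j k" and c: "0 < c"
    "\<And>k. 1 \<le> k \<Longrightarrow> j (k + 1) + c * (norm (z (k + 1) - z k))\<^sup>2 \<le> j k"
    by (rule real_objective_sequence) blast
  note KL' = KL[unfolded J_def]
  have "lim (\<lambda>m. J (z m)) = ereal js"
    using js(1) by (intro limI) (simp add: J_def j)
  then have r: "r k = ereal (j k - js)" for k
    using js(2)[of k] by (simp add: r_def objective_gap_def J_def j)
  have gap_lim: "(\<lambda>k. j k - js) \<longlonglongrightarrow> 0"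
    using js(1) by (simp add: LIM_zero)
  obtain K k0 where K: "0 < K" "\<And>k. k0 \<le> k \<Longrightarrow> js < j (k + 2) \<Longrightarrow>
    (j (k + 2) - js) powr (2 - 2 * \<theta>) \<le> K * (j k - j (k + 2))"
    by (rule gap_two_step[OF \<theta>(1) C KL' j js(1) c]) blast+
  \<comment> \<open>For \<open>\<theta> = 1\<close> the exponent is 0 and a positive gap to the
    power 0 is 1. So, from some index on, a positive gap would force a decrease of at least
    \<open>1 / K\<close> over the two preceding steps, which convergence of the values rules
    out.\<close>
  have finite_termination: "\<exists>k. r k = 0 \<and> (\<forall>m\<ge>k. z m = z k)" if "\<theta> = 1"
  proof -
    have "(\<lambda>k. K * (j k - j (k + 2))) \<longlonglongrightarrow> K * (js - js)"
      by (intro tendsto_intros js(1) LIMSEQ_ignore_initial_segment)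
    then have "eventually (\<lambda>k. K * (j k - j (k + 2)) < 1) sequentially"
      by (rule order_tendstoD(2)) simp
    then obtain k1 where k1: "\<And>k. k1 \<le> k \<Longrightarrow> K * (j k - j (k + 2)) < 1"
      by (auto simp: eventually_sequentially)
    define n where "n = max k0 k1 + 2"
    have zero: "j m = js" if m: "n \<le> m" for m
    proof (rule ccontr)
      assume "j m \<noteq> js"
      define k where "k = m - 2"
      have k: "k0 \<le> k" "k1 \<le> k" "m = k + 2" using m by (auto simp: k_def n_def)
      have "js < j (k + 2)" using \<open>j m \<noteq> js\<close> js(2)[of m] k(3) by simp
      with K(2)[OF k(1)] k1[OF k(2)] \<open>\<theta> = 1\<close> show False by simp
    qed
    \<comment> \<open>Constant values leave no room for the guaranteed decrease, so every further
      step has length 0; \<open>n \<ge> 2\<close> puts \<open>m\<close> in the range of that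
      decrease.\<close>
    have "z m = z n" if "n \<le> m" for m
      using that
    proof (induction m rule: dec_induct)
      case (step m)
      have "c * (norm (z (m + 1) - z m))\<^sup>2 \<le> 0"
        using c(2)[of m] zero[of m] zero[of "m + 1"] step(1) by (simp add: n_def)
      then have "norm (z (m + 1) - z m) = 0"
        using c(1) by (simp add: mult_le_0_iff)
      with step.IH show ?case by simp
    qed simp
    moreover have "r n = 0" using zero[of n] by (simp add: r)
    ultimately show ?thesis by blast
  qed
  have linear: "\<exists>c\<^sub>1>0. \<exists>q. 0 < q \<and> q < 1 \<and> (\<exists>k\<^sub>2. \<forall>k\<ge>k\<^sub>2. r k \<le> ereal (c\<^sub>1 * q ^ (k - k\<^sub>2)))"
    if half: "1 / 2 \<le> \<theta>"
  proof -
    \<comment> \<open>Once a positive gap is below 1, raising it to the exponent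
      \<open>2 - 2 * \<theta> \<le> 1\<close> can only enlarge it, so the power inequality implies a
      linear one.\<close>
    obtain k1 where k1: "\<And>k. k1 \<le> k \<Longrightarrow> j k - js < 1"
      using order_tendstoD(2)[OF gap_lim, of 1] by (auto simp: eventually_sequentially)
    define n where "n = max k0 k1"
    have n: "k0 \<le> n" "k1 \<le> n" by (simp_all add: n_def)
    obtain c1 q where cq: "0 < c1" "0 < q" "q < 1" "\<And>m. j (n + m) - js \<le> c1 * q ^ m"
    proof (rule two_step_linear_rate[of "2 - 2 * \<theta>" K "\<lambda>m. j (n + m) - js"])
      show "2 - 2 * \<theta> \<le> 1" using half by simp
      show "0 < K" by (rule K(1))
      show "0 \<le> j (n + m) - js" for m using js(2)[of "n + m"] by simp
      show "j (n + m) - js \<le> 1" for m using k1[of "n + m"] n(2) by (simp add: less_imp_le)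
      show "(j (n + (m + 2)) - js) powr (2 - 2 * \<theta>) \<le> K * (j (n + m) - js - (j (n + (m + 2)) - js))"
        if "0 < j (n + (m + 2)) - js" for m
        using K(2)[of "n + m"] n(1) that by (simp add: add.assoc)
    qed blast
    have "r k \<le> ereal (c1 * q ^ (k - n))" if "n \<le> k" for k
      using cq(4)[of "k - n"] that by (simp add: r)
    with cq(1-3) show ?thesis by blast
  qed
  have sublinear: "\<exists>c\<^sub>2>0. \<exists>k\<^sub>3. \<forall>k>k\<^sub>3. r k \<le> ereal (c\<^sub>2 * real (k - k\<^sub>3) powr (- (1 / (1 - 2 * \<theta>))))"
    if half: "\<theta> < 1 / 2"
  proof -
    \<comment> \<open>With \<open>\<alpha> = 2 - 2 * \<theta>\<close> the exponent
      \<open>1 / (\<alpha> - 1)\<close> is \<open>1 / (1 - 2 * \<theta>)\<close>.\<close>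
    obtain c2 where c2: "0 < c2"
      "\<And>m. 1 \<le> m \<Longrightarrow> j (k0 + m) - js \<le> c2 * real m powr (- (1 / (2 - 2 * \<theta> - 1)))"
    proof (rule two_step_sublinear_rate[of "2 - 2 * \<theta>" K "\<lambda>m. j (k0 + m) - js"])
      show "1 < 2 - 2 * \<theta>" using half by simp
      show "0 < K" by (rule K(1))
      show "(j (k0 + (m + 2)) - js) powr (2 - 2 * \<theta>) \<le> K * (j (k0 + m) - js - (j (k0 + (m + 2)) - js))" for m
      proof (cases "js < j (k0 + m + 2)")
        case True
        then show ?thesis using K(2)[of "k0 + m"] by (simp add: add.assoc)
      next
        \<comment> \<open>At a vanishing gap the left side is \<open>0 powr _ = 0\<close>, and the
          right side is nonnegative.\<close>
        case False
        then have "j (k0 + (m + 2)) = js" using js(2)[of "k0 + (m + 2)"] by (simp add: add.assoc)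
        then show ?thesis using K(1) js(2)[of "k0 + m"] by simp
      qed
    qed blast
    have "r k \<le> ereal (c2 * real (k - k0) powr (- (1 / (1 - 2 * \<theta>))))" if "k0 < k" for k
      using c2(2)[of "k - k0"] that by (simp add: r)
    with c2(1) show ?thesis by blast
  qed
  show ?thesis using finite_termination linear sublinear by blast
qed

end
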